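(* Let $n\ge 3$ and let $p\in\mathbb{C}[z_1,\dots,z_n]$ be a quadratic polynomial with hyperbolic initial form. Up to the action of $G_n$, the imaginary projection $\mathcal{I}(p)$ is either $\mathbb{R}^n$, or $\mathbb{R}^n\setminus\{(0,\dots,0,y_n)\in\mathbb{R}^n : y_n\neq 0\}$, or otherwise we can write $p$ as $p=\sum_{i=1}^{n-1}z_i^2-z_n^2+\gamma$ for some $\gamma\in\mathbb{C}$ such that $|\gamma|=1$, and we get \[ \mathcal{I}(p)= \begin{cases} \left\{\mathbf{y}\in\mathbb{R}^n : y_n^2<\sum_{i=1}^{n-1}y_i^2\right\}\cup\{\mathbf{0}\} & \text{if } \gamma=1,\\ \left\{\mathbf{y}\in\mathbb{R}^n : y_n^2-\sum_{i=1}^{n-1}y_i^2\le 1\right\} & \text{if } \gamma=-1,\\ \left\{\mathbf{y}\in\mathbb{R}^n : y_n^2-\sum_{i=1}^{n-1}y_i^2\le \tfrac12\left(1-\gamma_{\mathrm{re}}\right)\right\}\setminus\{\mathbf{0}\} & \text{if } \gamma\notin\mathbb{R}. \end{cases} \]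
   Context: For $p\in\mathbb{C}[z_1,\dots,z_n]$ with complex variety $\mathcal{V}(p)=\{\mathbf{z}\in\mathbb{C}^n : p(\mathbf{z})=0\}$, the imaginary projection is $\mathcal{I}(p)=\{(\operatorname{Im} z_1,\dots,\operatorname{Im} z_n) : \mathbf{z}\in\mathcal{V}(p)\}\subseteq\mathbb{R}^n$. A quadratic polynomial is one of total degree two. The initial form of $p$ consists of the terms of $p$ of maximal total degree. A polynomial $h\in\mathbb{C}[z_1,\dots,z_n]$ is hyperbolic with respect to $\mathbf{e}\in\mathbb{R}^n$ if for every $\mathbf{x}\in\mathbb{R}^n$ the univariate polynomial $t\mapsto h(\mathbf{x}+t\mathbf{e})$ is real-rooted; it is hyperbolic if this holds for some $\mathbf{e}\in\mathbb{R}^n$. $G_n=\mathbb{C}^n\rtimes\mathrm{GL}_n(\mathbb{R})$ is the group given by real invertible linear transformations and complex translations of the variables, acting on polynomials by substitution. For $\gamma\in\mathbb{C}$, $\gamma_{\mathrm{re}}$ denotes its real part. Normal forms: under the action of $G_n$, any quadratic polynomial with hyperbolic initial form can be transformed to one of (1) $z_1^2+\alpha z_2+rz_3+\gamma$ or (2) $\sum_{i=1}^{j}z_i^2-z_{j+1}^2+\alpha z_{j+2}+rz_{j+3}+\gamma$ for some $j=1,\dots,n-1$, such that terms containing $z_k$ do not appear for $k>n$, and $\alpha,r,\gamma\in\mathbb{C}$. To avoid redundancy, for each quadratic polynomial $n$ is set to be the largest index of $z$ appearing in its normal form.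
   Formalization: The printed list omits p equivalent to z_1^2+...+z_{n-1}^2-z_n^2 (γ=0), so this case is added, with I(p)={y_n^2 ≤ sum of the other y_i^2}; p is written in its form up to a nonzero constant factor, and every normal form of p is taken to have largest index n. *)

theory Defs
  imports Complex_Main "HOL-Library.Poly_Mapping" "Jordan_Normal_Form.Matrix"
begin

text \<open>
  Complex polynomials in countably many indeterminates; a monomial maps each variable to its
  exponent. Variables are numbered from 0, so the polynomial ring in \<open>z_1, \<dots>, z_n\<close> consists of
  the polynomials \<open>p\<close> with \<open>indets p \<subseteq> {..<n}\<close>, and \<open>z_k\<close> is \<open>Var (k - 1)\<close>. Points of
  complex and real \<open>n\<close>-space are the elements of \<open>carrier_vec n\<close>, with coordinates numbered from 0.
\<close>

type_synonym cpoly = "(nat \<Rightarrow>\<^sub>0 nat) \<Rightarrow>\<^sub>0 complex"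

definition Const :: "complex \<Rightarrow> cpoly" where
  "Const c = Poly_Mapping.single 0 c"

definition Var :: "nat \<Rightarrow> cpoly" where
  "Var i = Poly_Mapping.single (Poly_Mapping.single i 1) 1"

definition indets :: "cpoly \<Rightarrow> nat set" where
  "indets p = (\<Union>m\<in>Poly_Mapping.keys p. Poly_Mapping.keys m)"

definition mdeg :: "(nat \<Rightarrow>\<^sub>0 nat) \<Rightarrow> nat" where
  "mdeg m = (\<Sum>i\<in>Poly_Mapping.keys m. Poly_Mapping.lookup m i)"

definition total_degree :: "cpoly \<Rightarrow> nat" where
  "total_degree p = Max (insert 0 (mdeg ` Poly_Mapping.keys p))"

definition initial_form :: "cpoly \<Rightarrow> cpoly" where
  "initial_form p = (\<Sum>m | m \<in> Poly_Mapping.keys p \<and> mdeg m = total_degree p.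
     Poly_Mapping.single m (Poly_Mapping.lookup p m))"

definition eval :: "cpoly \<Rightarrow> complex vec \<Rightarrow> complex" where
  "eval p z = (\<Sum>m\<in>Poly_Mapping.keys p. Poly_Mapping.lookup p m *
     (\<Prod>i\<in>Poly_Mapping.keys m. (z $ i) ^ Poly_Mapping.lookup m i))"

definition subst :: "(nat \<Rightarrow> cpoly) \<Rightarrow> cpoly \<Rightarrow> cpoly" where
  "subst f p = (\<Sum>m\<in>Poly_Mapping.keys p. Const (Poly_Mapping.lookup p m) *
     (\<Prod>i\<in>Poly_Mapping.keys m. f i ^ Poly_Mapping.lookup m i))"

definition variety :: "nat \<Rightarrow> cpoly \<Rightarrow> complex vec set" where
  "variety n p = {z \<in> carrier_vec n. eval p z = 0}"

definition imag_proj :: "nat \<Rightarrow> cpoly \<Rightarrow> real vec set" where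
  "imag_proj n p = map_vec Im ` variety n p"

text \<open>
  Real-rooted means that every complex zero is real, so the zero polynomial is not real-rooted.
  For homogeneous \<open>h\<close> of positive degree, taking \<open>x = 0\<close> therefore forces \<open>h(e) \<noteq> 0\<close>.
\<close>

definition hyperbolic_wrt :: "nat \<Rightarrow> cpoly \<Rightarrow> real vec \<Rightarrow> bool" where
  "hyperbolic_wrt n h e \<longleftrightarrow> e \<in> carrier_vec n \<and>
     (\<forall>x \<in> carrier_vec n. \<forall>t::complex.
        eval h (map_vec complex_of_real x + t \<cdot>\<^sub>v map_vec complex_of_real e) = 0 \<longrightarrow> t \<in> \<real>)"

definition hyperbolic :: "nat \<Rightarrow> cpoly \<Rightarrow> bool" where
  "hyperbolic n h \<longleftrightarrow> (\<exists>e. hyperbolic_wrt n h e)"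

text \<open>The pair \<open>(b, A)\<close> stands for the substitution \<open>z \<mapsto> A z + b\<close>.\<close>

definition G :: "nat \<Rightarrow> (complex vec \<times> real mat) set" where
  "G n = carrier_vec n \<times> {A \<in> carrier_mat n n. invertible_mat A}"

definition act :: "nat \<Rightarrow> complex vec \<times> real mat \<Rightarrow> cpoly \<Rightarrow> cpoly" where
  "act n g p = subst (\<lambda>i. (\<Sum>k<n. Const (complex_of_real (snd g $$ (i, k))) * Var k)
                          + Const (fst g $ i)) p"

text \<open>
  The two families of normal forms. The condition on \<open>indets\<close> says that terms containing \<open>z_k\<close>
  do not appear for \<open>k > n\<close>.
\<close>

definition normal_form :: "nat \<Rightarrow> cpoly \<Rightarrow> bool" where
  "normal_form n q \<longleftrightarrow> indets q \<subseteq> {..<n} \<and>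
     ((\<exists>\<alpha> r \<gamma>. q = Var 0 ^ 2 + Const \<alpha> * Var 1 + Const r * Var 2 + Const \<gamma>) \<or>
      (\<exists>j \<alpha> r \<gamma>. 1 \<le> j \<and> j \<le> n - 1 \<and>
         q = (\<Sum>i<j. Var i ^ 2) - Var j ^ 2 + Const \<alpha> * Var (j + 1) + Const r * Var (j + 2)
             + Const \<gamma>))"

text \<open>
  Nonzero constant factors, which do not affect the variety, are disregarded: a normal form has
  leading coefficient 1, and substitutions alone do not turn \<open>\<i> z_1\<^sup>2\<close> into such a polynomial.
\<close>

definition normal_form_of :: "nat \<Rightarrow> cpoly \<Rightarrow> cpoly \<Rightarrow> bool" where
  "normal_form_of n p q \<longleftrightarrow> normal_form n q \<and> (\<exists>g \<in> G n. \<exists>c. c \<noteq> 0 \<and> act n g p = Const c * q)"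

text \<open>The largest \<open>k\<close> such that \<open>z_k\<close> appears (counting from 1).\<close>

definition largest_index :: "cpoly \<Rightarrow> nat" where
  "largest_index q = Max (Suc ` indets q)"

definition lorentz :: "nat \<Rightarrow> complex \<Rightarrow> cpoly" where
  "lorentz n \<gamma> = (\<Sum>i<n - 1. Var i ^ 2) - Var (n - 1) ^ 2 + Const \<gamma>"

end

(* Hyperbolicity with respect to e bounds the discriminants of t -> h(x + t e). Dividing by -h(e)
   gives a real quadratic form Q, with polarisation B, such that Q(e) = -1 and Q(x) + B(x,e)^2 >= 0,
   so Q is positive semidefinite on the orthogonal complement of e. A maximal orthonormal family
   in that complement, together with e, diagonalises Q as a sum of squares of real linear forms
   minus one further square. Completing squares leaves a complex linear form on the radical, whose
   real and imaginary parts are zero, span a line, or are independent; extending all these forms to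
   a basis of the dual space yields the normal form. If a linear part survives, the defining
   equation can be solved for the real parts directly. Otherwise z = x + iy is a zero iff
   Q(x) = Q(y) - Re gamma and 2 B(x,y) = -Im gamma in Lorentzian space, where the reversed
   Cauchy-Schwarz inequality for timelike y gives the only obstruction. *)
theory Submission
  imports Defs "Jordan_Normal_Form.Determinant"
begin

section \<open>Polynomial evaluation and substitution\<close>

text \<open>The bound \<open>n \<ge> 3\<close> enters through \<open>j\<close>. Without a linear
  part, \<open>j = n - 1 \<ge> 2\<close>, so there is a space direction orthogonal to the spatial
  part of \<open>y\<close>; moving \<open>x\<close> along it raises Q(x) and keeps B(x,y) fixed. The
  equation for Q(x) thus relaxes to an inequality in a plane with one space and one time axis, and
  existence becomes a question about two numbers \<open>s\<close> and \<open>t\<close>. With one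
  linear term left, \<open>j = n - 2 \<ge> 1\<close> makes Q indefinite, hence onto the reals. The
  constant (1 - Re gamma)/2 comes from the reversed Cauchy-Schwarz inequality: for q = Q(y) < 0 it
  reads (q - Re gamma) q \<le> (Im gamma)^2 / 4, which for |gamma| = 1 is (q - Re gamma / 2)^2 \<le>
  1/4. Scaling brings a nonzero gamma to modulus 1 but cannot move gamma = 0; the closed cone
  belonging to it is an alternative of its own in the conclusion. The assumption on largest indices
  rules out missing variables: the form that is found involves only \<open>m\<close> variables, so
  \<open>m = n\<close>, which ties \<open>j\<close> to \<open>n\<close>.\<close>

lemma sum_keys_single: "(\<Sum>m\<in>Poly_Mapping.keys p. Poly_Mapping.single m (Poly_Mapping.lookup p m)) = p"
proof (rule poly_mapping_eqI)
  fix k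
  show "Poly_Mapping.lookup (\<Sum>m\<in>Poly_Mapping.keys p. Poly_Mapping.single m (Poly_Mapping.lookup p m)) k
    = Poly_Mapping.lookup p k"
    by (simp add: lookup_sum lookup_single when_def in_keys_iff)
qed

text \<open>The step case puts no condition on the supports of \<open>p\<close> and
  \<open>q\<close>, so additivity of a map settles it. Two nested inductions then reduce
  multiplicativity to products of monomials.\<close>

lemma cpoly_induct [case_names single add]:
  fixes p :: cpoly
  assumes single: "\<And>m a. P (Poly_Mapping.single m a)"
    and add: "\<And>p q. P p \<Longrightarrow> P q \<Longrightarrow> P (p + q)"
  shows "P p"
proof -
  have "P (\<Sum>m\<in>M. Poly_Mapping.single m (Poly_Mapping.lookup p m))" if "finite M" for M
    using that
  proof induction
    case empty
    then show ?case using single[of 0 0] by simp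
  qed (simp add: single add)
  from this[of "Poly_Mapping.keys p"] show ?thesis by (simp add: sum_keys_single)
qed

definition mon :: "(nat \<Rightarrow> 'a::comm_ring_1) \<Rightarrow> (nat \<Rightarrow>\<^sub>0 nat) \<Rightarrow> 'a" where
  "mon f m = (\<Prod>i\<in>Poly_Mapping.keys m. f i ^ Poly_Mapping.lookup m i)"

lemma mon_superset:
  assumes "finite S" "Poly_Mapping.keys m \<subseteq> S"
  shows "mon f m = (\<Prod>i\<in>S. f i ^ Poly_Mapping.lookup m i)"
  unfolding mon_def using assms
  by (intro prod.mono_neutral_left) (auto simp: in_keys_iff)

lemma mon_zero [simp]: "mon f 0 = 1"
  by (simp add: mon_def)

lemma mon_single [simp]: "mon f (Poly_Mapping.single i k) = f i ^ k"
  by (simp add: mon_def)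

lemma mon_add: "mon f (m + m') = mon f m * mon f m'"
proof -
  let ?S = "Poly_Mapping.keys m \<union> Poly_Mapping.keys m'"
  have "Poly_Mapping.keys (m + m') \<subseteq> ?S" by (rule Poly_Mapping.keys_add)
  then show ?thesis
    by (simp add: mon_superset[of ?S] lookup_add power_add prod.distrib)
qed

text \<open>The universal property of the polynomial ring, proved once: \<open>\<phi>\<close> acts
  on coefficients and \<open>f\<close> on variables. For evaluation \<open>\<phi>\<close> is the
  identity on complex numbers, for substitution it is \<open>Const\<close>.\<close>

locale coeff_hom =
  fixes \<phi> :: "complex \<Rightarrow> 'a::comm_ring_1" and f :: "nat \<Rightarrow> 'a" and \<Phi> :: "cpoly \<Rightarrow> 'a"
  assumes coeff_add: "\<phi> (a + b) = \<phi> a + \<phi> b"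
    and coeff_mult: "\<phi> (a * b) = \<phi> a * \<phi> b"
    and coeff_one: "\<phi> 1 = 1"
    and Phi_def: "\<Phi> p = (\<Sum>m\<in>Poly_Mapping.keys p. \<phi> (Poly_Mapping.lookup p m) * mon f m)"
begin

lemma coeff_zero: "\<phi> 0 = 0"
  using coeff_add[of 0 0] by simp

lemma hom_add: "\<Phi> (p + q) = \<Phi> p + \<Phi> q"
  unfolding Phi_def
  by (rule setsum_keys_plus_distrib) (simp_all add: coeff_zero coeff_add distrib_right)

lemma hom_single: "\<Phi> (Poly_Mapping.single m a) = \<phi> a * mon f m"
  by (simp add: Phi_def coeff_zero)

lemma hom_mult: "\<Phi> (p * q) = \<Phi> p * \<Phi> q"
proof (induction p rule: cpoly_induct)
  case (single m a)
  show ?case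
    by (induction q rule: cpoly_induct)
      (simp_all add: mult_single hom_single coeff_mult mon_add hom_add algebra_simps)
qed (simp add: hom_add distrib_right)

lemma hom_Const: "\<Phi> (Const a) = \<phi> a"
  by (simp add: Const_def hom_single)

lemma hom_Var: "\<Phi> (Var i) = f i"
  by (simp add: Var_def hom_single coeff_one)

lemma hom_one: "\<Phi> 1 = 1"
  using hom_Const[of 1] by (simp add: Const_def coeff_one)

lemma hom_zero: "\<Phi> 0 = 0"
  using hom_add[of 0 0] by simp

lemma hom_uminus: "\<Phi> (- p) = - \<Phi> p"
  using hom_add[of p "- p"] by (simp add: hom_zero eq_neg_iff_add_eq_0 add.commute)

lemma hom_diff: "\<Phi> (p - q) = \<Phi> p - \<Phi> q"
  using hom_add[of p "- q"] by (simp add: hom_uminus)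

lemma hom_sum: "\<Phi> (\<Sum>i\<in>S. g i) = (\<Sum>i\<in>S. \<Phi> (g i))"
  by (induction S rule: infinite_finite_induct) (simp_all add: hom_zero hom_add)

lemma hom_power: "\<Phi> (p ^ k) = \<Phi> p ^ k"
  by (induction k) (simp_all add: hom_one hom_mult)

lemmas hom_simps = hom_add hom_mult hom_Const hom_Var hom_one hom_zero hom_uminus hom_diff
  hom_sum hom_power

end

lemma Const_add: "Const (a + b) = Const a + Const b"
  by (simp add: Const_def single_add)

lemma Const_mult: "Const (a * b) = Const a * Const b"
  by (simp add: Const_def mult_single)

lemma Const_zero [simp]: "Const 0 = 0"
  by (simp add: Const_def)

lemma Const_one [simp]: "Const 1 = 1"
  by (simp add: Const_def)

lemma Const_uminus: "Const (- a) = - Const a"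
  by (simp add: Const_def single_uminus)

lemma Const_sum: "Const (\<Sum>i\<in>S. f i) = (\<Sum>i\<in>S. Const (f i))"
  by (induction S rule: infinite_finite_induct) (simp_all add: Const_add)

lemma Const_power: "Const (a ^ k) = Const a ^ k"
  by (induction k) (simp_all add: Const_mult)

interpretation eval: coeff_hom "\<lambda>a. a" "\<lambda>i. z $ i" "\<lambda>p. eval p z" for z
  by unfold_locales (simp_all add: eval_def mon_def)

interpretation subst: coeff_hom Const f "subst f" for f
  by unfold_locales (simp_all add: Const_add Const_mult subst_def mon_def)

lemma indets_add: "indets (p + q) \<subseteq> indets p \<union> indets q"
  using Poly_Mapping.keys_add[of p q] by (auto simp: indets_def)

lemma indets_uminus [simp]: "indets (- p) = indets p"
  by (simp add: indets_def in_keys_iff)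

lemma indets_mult: "indets (p * q) \<subseteq> indets p \<union> indets q"
proof
  fix i assume "i \<in> indets (p * q)"
  then obtain m where "m \<in> Poly_Mapping.keys (p * q)" "i \<in> Poly_Mapping.keys m"
    by (auto simp: indets_def)
  then obtain a b where "m = a + b" "a \<in> Poly_Mapping.keys p" "b \<in> Poly_Mapping.keys q"
    using keys_mult[of p q] by blast
  with \<open>i \<in> Poly_Mapping.keys m\<close> Poly_Mapping.keys_add[of a b] show "i \<in> indets p \<union> indets q"
    by (auto simp: indets_def)
qed

lemma indets_Const [simp]: "indets (Const a) = {}"
  by (simp add: indets_def Const_def)

lemma indets_Var [simp]: "indets (Var i) = {i}"
  by (simp add: indets_def Var_def)

lemma indets_power: "indets (p ^ k) \<subseteq> indets p"
proof (induction k)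
  case 0
  show ?case using indets_Const[of 1] by simp
next
  case (Suc k)
  then show ?case using indets_mult[of p "p ^ k"] by auto
qed

lemma indets_sum: "indets (\<Sum>i\<in>S. f i) \<subseteq> (\<Union>i\<in>S. indets (f i))"
proof (induction S rule: infinite_finite_induct)
  case (insert x S)
  then show ?case using indets_add[of "f x" "sum f S"] by auto
qed (simp_all add: indets_def)

lemma indets_empty_const:
  assumes "indets p = {}"
  shows "p = Const (Poly_Mapping.lookup p 0)"
proof (rule poly_mapping_eqI)
  fix m
  have "m \<notin> Poly_Mapping.keys p" if "m \<noteq> 0"
    using that assms by (auto simp: indets_def)
  then show "Poly_Mapping.lookup p m = Poly_Mapping.lookup (Const (Poly_Mapping.lookup p 0)) m"
    by (auto simp: Const_def lookup_single when_def in_keys_iff)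
qed

section \<open>Quadratic polynomials\<close>

definition lin :: "nat \<Rightarrow> (nat \<Rightarrow> complex) \<Rightarrow> cpoly" where
  "lin n a = (\<Sum>i<n. Const (a i) * Var i)"

lemma lin_add: "lin n (\<lambda>i. a i + b i) = lin n a + lin n b"
  by (simp add: lin_def Const_add distrib_right sum.distrib)

lemma lin_scale: "lin n (\<lambda>i. c * a i) = Const c * lin n a"
  by (simp add: lin_def Const_mult sum_distrib_left mult.assoc)

lemma lin_sum: "lin n (\<lambda>i. \<Sum>r\<in>S. a r i) = (\<Sum>r\<in>S. lin n (a r))"
  unfolding lin_def Const_sum sum_distrib_right by (rule sum.swap)

lemma lin_cong: "(\<And>i. i < n \<Longrightarrow> a i = b i) \<Longrightarrow> lin n a = lin n b"
  by (simp add: lin_def)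

definition qf :: "nat \<Rightarrow> (nat \<Rightarrow> nat \<Rightarrow> complex) \<Rightarrow> cpoly" where
  "qf n M = (\<Sum>i<n. \<Sum>k<n. Const (M i k) * (Var i * Var k))"

lemma mdeg_superset:
  assumes "finite S" "Poly_Mapping.keys m \<subseteq> S"
  shows "mdeg m = (\<Sum>i\<in>S. Poly_Mapping.lookup m i)"
  unfolding mdeg_def using assms
  by (intro sum.mono_neutral_left) (auto simp: in_keys_iff)

lemma mdeg_add: "mdeg (m + m') = mdeg m + mdeg m'"
proof -
  let ?S = "Poly_Mapping.keys m \<union> Poly_Mapping.keys m'"
  have "Poly_Mapping.keys (m + m') \<subseteq> ?S" by (rule Poly_Mapping.keys_add)
  then show ?thesis
    by (simp add: mdeg_superset[of ?S] lookup_add sum.distrib)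
qed

lemma mdeg_single [simp]: "mdeg (Poly_Mapping.single i k) = k"
  by (simp add: mdeg_def)

lemma mdeg_eq_0: "mdeg m = 0 \<longleftrightarrow> m = 0"
  by (auto simp: mdeg_def in_keys_iff intro!: poly_mapping_eqI)

text \<open>Monomials of degree 1 and 2 are recognised by peeling off one variable at a time; the
  inclusion of keys keeps the variables below \<open>n\<close>.\<close>

lemma mdeg_SucE:
  assumes "mdeg m = Suc d"
  obtains i m' where "m = Poly_Mapping.single i 1 + m'" "mdeg m' = d"
    "i \<in> Poly_Mapping.keys m" "Poly_Mapping.keys m' \<subseteq> Poly_Mapping.keys m"
proof -
  from assms have "m \<noteq> 0" using mdeg_eq_0[of m] by auto
  then obtain i where i: "i \<in> Poly_Mapping.keys m" by fastforce
  define m' where "m' = m - Poly_Mapping.single i 1"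
  have l: "Poly_Mapping.lookup m i \<ge> 1" using i by (simp add: in_keys_iff)
  have m: "m = Poly_Mapping.single i 1 + m'"
    by (rule poly_mapping_eqI) (use l in \<open>auto simp: m'_def lookup_add lookup_minus lookup_single when_def\<close>)
  moreover have "mdeg m' = d" using assms m mdeg_add[of "Poly_Mapping.single i 1" m'] by simp
  moreover have "Poly_Mapping.keys m' \<subseteq> Poly_Mapping.keys m"
    by (auto simp: m'_def in_keys_iff lookup_minus)
  ultimately show thesis using that i by blast
qed

lemma qf_add: "qf n (\<lambda>i k. M i k + N i k) = qf n M + qf n N"
  by (simp add: qf_def Const_add distrib_right sum.distrib)

lemma single_degree_0: "mdeg m = 0 \<Longrightarrow> Poly_Mapping.single m a = Const a"
  by (simp add: mdeg_eq_0 Const_def)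

lemma sum_lessThan_delta:
  fixes f :: "nat \<Rightarrow> 'a::semiring_1"
  assumes "i < n"
  shows "(\<Sum>k<n. (if k = i then 1 else 0) * f k) = f i"
proof -
  have "(\<Sum>k<n. (if k = i then 1 else 0) * f k) = (\<Sum>k<n. if k = i then f k else 0)"
    by (rule sum.cong) auto
  then show ?thesis using assms by simp
qed

lemma single_degree_1:
  assumes "mdeg m = 1" "Poly_Mapping.keys m \<subseteq> {..<n}"
  shows "\<exists>l. Poly_Mapping.single m a = lin n l"
proof -
  obtain i m' where m: "m = Poly_Mapping.single i 1 + m'" "mdeg m' = 0" "i \<in> Poly_Mapping.keys m"
    using assms(1) by (auto elim: mdeg_SucE)
  then have m: "m = Poly_Mapping.single i 1" and "i < n"
    using assms(2) mdeg_eq_0[of m'] by auto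
  have "lin n (\<lambda>k. a * (if k = i then 1 else 0)) = Const a * Var i"
    using \<open>i < n\<close> sum_lessThan_delta[of i n Var]
    by (simp only: lin_scale) (simp add: lin_def if_distrib[of Const] cong: if_cong)
  also have "\<dots> = Poly_Mapping.single m a"
    by (simp add: m Const_def Var_def mult_single)
  finally show ?thesis by metis
qed

lemma single_degree_2:
  assumes "mdeg m = 2" "Poly_Mapping.keys m \<subseteq> {..<n}"
  shows "\<exists>M. (\<forall>i k. M i k = M k i) \<and> Poly_Mapping.single m a = qf n M"
proof -
  obtain i m' where m: "m = Poly_Mapping.single i 1 + m'" "mdeg m' = 1" "i \<in> Poly_Mapping.keys m"
      "Poly_Mapping.keys m' \<subseteq> Poly_Mapping.keys m"
    using assms(1) mdeg_SucE[of m 1] by (metis Suc_1)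
  obtain k m'' where m': "m' = Poly_Mapping.single k 1 + m''" "mdeg m'' = 0" "k \<in> Poly_Mapping.keys m'"
    using m(2) by (auto elim: mdeg_SucE)
  have mm: "m = Poly_Mapping.single i 1 + Poly_Mapping.single k 1" and "i < n" "k < n"
    using assms(2) mdeg_eq_0[of m''] m m' by auto
  let ?d = "\<lambda>x y. if x = y then 1 else (0::complex)"
  \<comment> \<open>Half of the coefficient goes to each of the two mixed entries, which makes
    \<open>M\<close> symmetric; for \<open>i = k\<close> the halves add up to \<open>a\<close> on
    the diagonal.\<close>
  define M where "M = (\<lambda>x y. ?d x i * ?d y k * (a / 2) + ?d x k * ?d y i * (a / 2))"
  have qf_d: "qf n (\<lambda>x y. ?d x u * ?d y v * (a/2)) = Const (a/2) * (Var u * Var v)"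
    if "u < n" "v < n" for u v
  proof -
    have "qf n (\<lambda>x y. ?d x u * ?d y v * (a/2))
      = (\<Sum>x<n. (if x = u then 1 else 0) * (\<Sum>y<n. (if y = v then 1 else 0) * (Const (a/2) * (Var x * Var y))))"
      unfolding qf_def sum_distrib_left by (intro sum.cong refl) simp
    also have "\<dots> = Const (a/2) * (Var u * Var v)"
      using that by (simp add: sum_lessThan_delta)
    finally show ?thesis .
  qed
  have "qf n M = Const (a/2) * (Var i * Var k) + Const (a/2) * (Var k * Var i)"
    unfolding M_def qf_add by (simp only: qf_d \<open>i < n\<close> \<open>k < n\<close>)
  also have "\<dots> = Const (a/2 + a/2) * (Var i * Var k)"
    by (simp only: Const_add distrib_right mult.commute[of "Var k"])
  also have "\<dots> = Poly_Mapping.single m a"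
    by (simp add: mm Const_def Var_def mult_single)
  finally have "qf n M = Poly_Mapping.single m a" .
  moreover have "M x y = M y x" for x y by (auto simp: M_def)
  ultimately show ?thesis by metis
qed

lemma sum_qf:
  assumes "finite S" "\<And>m. m \<in> S \<Longrightarrow> \<exists>M. (\<forall>i k. M i k = M k i) \<and> g m = qf n M"
  shows "\<exists>M. (\<forall>i k. M i k = M k i) \<and> (\<Sum>m\<in>S. g m) = qf n M"
  using assms
proof induction
  case empty
  have "qf n (\<lambda>_ _. 0) = 0" by (simp add: qf_def)
  then show ?case by (metis sum.empty)
next
  case (insert m S)
  then obtain M N where "\<forall>i k. M i k = M k i" "g m = qf n M" "\<forall>i k. N i k = N k i" "sum g S = qf n N"
    by (metis insertCI)
  with insert.hyps show ?case
    by (intro exI[of _ "\<lambda>i k. M i k + N i k"]) (simp add: qf_add)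
qed

lemma sum_affine:
  assumes "finite S" "\<And>m. m \<in> S \<Longrightarrow> \<exists>l k. g m = lin n l + Const k"
  shows "\<exists>l k. (\<Sum>m\<in>S. g m) = lin n l + Const k"
  using assms
proof induction
  case empty
  have "lin n (\<lambda>_. 0) + Const 0 = 0" by (simp add: lin_def)
  then show ?case by (metis sum.empty)
next
  case (insert m S)
  then obtain l k l' k' where "g m = lin n l + Const k" "sum g S = lin n l' + Const k'"
    by (metis insertCI)
  with insert.hyps show ?case
    by (intro exI[of _ "\<lambda>i. l i + l' i"] exI[of _ "k + k'"]) (simp add: lin_add Const_add)
qed

lemma quadratic_decomposition:
  assumes "indets p \<subseteq> {..<n}" "total_degree p = 2"
  obtains M l k where "\<And>i k. M i k = M k i" "initial_form p = qf n M"
    "p = qf n M + lin n l + Const k"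
proof -
  let ?s = "\<lambda>m. Poly_Mapping.single m (Poly_Mapping.lookup p m)"
  let ?K = "Poly_Mapping.keys p"
  have deg: "mdeg m \<le> 2" if "m \<in> ?K" for m
    using assms(2) that Max_ge[of "insert 0 (mdeg ` ?K)" "mdeg m"] by (simp add: total_degree_def)
  have vars: "Poly_Mapping.keys m \<subseteq> {..<n}" if "m \<in> ?K" for m
    using assms(1) that by (auto simp: indets_def)
  obtain M where M: "\<forall>i k. M i k = M k i" "(\<Sum>m | m \<in> ?K \<and> mdeg m = 2. ?s m) = qf n M"
    using sum_qf[of "{m \<in> ?K. mdeg m = 2}" ?s n] single_degree_2 vars by auto
  have affine: "\<exists>l k. ?s m = lin n l + Const k" if "m \<in> ?K" "mdeg m \<noteq> 2" for m
  proof (cases "mdeg m = 0")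
    case True
    have "lin n (\<lambda>_. 0) = 0" by (simp add: lin_def)
    with True show ?thesis by (metis single_degree_0 add_0)
  next
    case False
    with deg[OF that(1)] that(2) have "mdeg m = 1" by linarith
    then show ?thesis using single_degree_1[OF _ vars[OF that(1)]] by (metis Const_zero add_0_right)
  qed
  obtain l k where l: "(\<Sum>m | m \<in> ?K \<and> mdeg m \<noteq> 2. ?s m) = lin n l + Const k"
    using sum_affine[of "{m \<in> ?K. mdeg m \<noteq> 2}" ?s n] affine by auto
  have "p = (\<Sum>m\<in>?K. ?s m)" by (simp add: sum_keys_single)
  also have "\<dots> = (\<Sum>m | m \<in> ?K \<and> mdeg m = 2. ?s m) + (\<Sum>m | m \<in> ?K \<and> mdeg m \<noteq> 2. ?s m)"
    by (subst sum.union_disjoint[symmetric]) (auto intro!: sum.cong)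
  finally have "p = qf n M + lin n l + Const k" by (simp add: M l add.assoc)
  moreover have "initial_form p = qf n M" using M(2) assms(2) by (simp add: initial_form_def)
  ultimately show thesis using that M(1) by blast
qed

section \<open>Linear forms\<close>

definition dot :: "nat \<Rightarrow> (nat \<Rightarrow> 'a::comm_ring_1) \<Rightarrow> (nat \<Rightarrow> 'a) \<Rightarrow> 'a" where
  "dot n a x = (\<Sum>i<n. a i * x i)"

text \<open>\<open>P r\<close> are the rows of an invertible matrix, \<open>A s\<close> the columns of its inverse.\<close>

definition dual_bases :: "nat \<Rightarrow> (nat \<Rightarrow> nat \<Rightarrow> real) \<Rightarrow> (nat \<Rightarrow> nat \<Rightarrow> real) \<Rightarrow> bool" where
  "dual_bases n P A \<longleftrightarrow> (\<forall>r<n. \<forall>s<n. dot n (P r) (A s) = (if r = s then 1 else 0))"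

lemma dot_add_left: "dot n (\<lambda>i. a i + b i) x = dot n a x + dot n b x"
  and dot_add_right: "dot n a (\<lambda>i. x i + y i) = dot n a x + dot n a y"
  and dot_diff_right: "dot n a (\<lambda>i. x i - y i) = dot n a x - dot n a y"
  and dot_scale_left: "dot n (\<lambda>i. c * a i) x = c * dot n a x"
  and dot_scale_right: "dot n a (\<lambda>i. c * x i) = c * dot n a x"
  by (simp_all add: dot_def sum.distrib sum_subtractf sum_distrib_left algebra_simps)

lemma dot_sum_left: "dot n (\<lambda>i. \<Sum>r\<in>S. a r i) x = (\<Sum>r\<in>S. dot n (a r) x)"
  unfolding dot_def sum_distrib_right by (rule sum.swap)

lemma dot_sum_right: "dot n a (\<lambda>i. \<Sum>r\<in>S. x r i) = (\<Sum>r\<in>S. dot n a (x r))"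
  unfolding dot_def sum_distrib_left by (rule sum.swap)

lemma dot_commute: "dot n a x = dot n x a"
  by (simp add: dot_def mult.commute)

lemma dot_cong: "(\<And>i. i < n \<Longrightarrow> a i = b i) \<Longrightarrow> (\<And>i. i < n \<Longrightarrow> x i = y i) \<Longrightarrow> dot n a x = dot n b y"
  by (simp add: dot_def)

definition unit_fun :: "nat \<Rightarrow> nat \<Rightarrow> 'a::comm_ring_1" where
  "unit_fun i k = (if k = i then 1 else 0)"

lemma dot_unit: "i < n \<Longrightarrow> dot n (unit_fun i) x = x i"
  using sum_lessThan_delta[of i n x] by (simp add: dot_def unit_fun_def)

lemma dot_unit_right: "i < n \<Longrightarrow> dot n a (unit_fun i) = a i"
  by (simp add: dot_commute[of n a] dot_unit)

lemma dual_bases_mat: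
  assumes "dual_bases n P A"
  shows "mat n n (\<lambda>(r, i). P r i) * mat n n (\<lambda>(i, s). A s i) = 1\<^sub>m n" (is "?P * ?A = _")
    and "mat n n (\<lambda>(i, s). A s i) * mat n n (\<lambda>(r, i). P r i) = 1\<^sub>m n"
proof -
  show *: "?P * ?A = 1\<^sub>m n"
    using assms by (intro eq_matI)
      (auto simp: dual_bases_def dot_def scalar_prod_def lessThan_atLeast0)
  show "?A * ?P = 1\<^sub>m n"
    by (rule mat_mult_left_right_inverse[OF _ _ *]) auto
qed

text \<open>Duality says that the rows times the columns give the identity matrix. The expansion
  needs the product in the other order, which is also the identity because the matrices are
  square.\<close>

lemma dual_bases_expand:
  assumes "dual_bases n P A" "k < n"
  shows "f k = (\<Sum>r<n. dot n f (A r) * P r k)"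
proof -
  let ?P = "mat n n (\<lambda>(r, i). P r i)" and ?A = "mat n n (\<lambda>(i, s). A s i)"
  have delta: "(\<Sum>r<n. A r i * P r k) = (if k = i then 1 else 0)" if "i < n" for i
  proof -
    have "(?A * ?P) $$ (i, k) = (\<Sum>r<n. A r i * P r k)"
      using that assms(2) by (simp add: scalar_prod_def lessThan_atLeast0)
    then show ?thesis using dual_bases_mat(2)[OF assms(1)] that assms(2) by auto
  qed
  have "(\<Sum>r<n. dot n f (A r) * P r k) = (\<Sum>i<n. f i * (\<Sum>r<n. A r i * P r k))"
    unfolding dot_def sum_distrib_left sum_distrib_right
    by (subst sum.swap) (simp add: mult.assoc)
  also have "\<dots> = (\<Sum>i<n. if k = i then f i else 0)"
    by (rule sum.cong) (auto simp: delta)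
  also have "\<dots> = f k" using assms(2) by simp
  finally show ?thesis by simp
qed

lemma dual_bases_swap:
  assumes "dual_bases n P A" "u < n" "v < n"
  shows "dual_bases n (P \<circ> Transposition.transpose u v) (A \<circ> Transposition.transpose u v)"
proof -
  let ?t = "Transposition.transpose u v"
  have "?t r < n" if "r < n" for r
    using that assms(2,3) by (auto simp: Transposition.transpose_def)
  then show ?thesis using assms(1)
    by (auto simp: dual_bases_def dest: injD[OF bij_is_inj[OF bij_transpose]])
qed

text \<open>Exchange step: \<open>A m\<close> is rescaled so that \<open>f\<close> takes the value 1
  on it, and a multiple of it is subtracted from each other \<open>A s\<close> to make
  \<open>f\<close> vanish there. The other rows vanish on \<open>A m\<close>, so their pairings do
  not change.\<close>

lemma dual_bases_replace:
  assumes "dual_bases n P A" "m < n" "dot n f (A m) \<noteq> 0"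
  shows "\<exists>A'. dual_bases n (P(m := f)) A'"
proof -
  define c where "c = 1 / dot n f (A m)"
  define A' where "A' s = (if s = m then (\<lambda>i. c * A m i)
    else (\<lambda>i. A s i - dot n f (A s) * c * A m i))" for s
  have "c * dot n f (A m) = 1" using assms(3) by (simp add: c_def)
  then have "dual_bases n (P(m := f)) A'"
    unfolding dual_bases_def A'_def
    using assms(1,2) by (simp add: dot_scale_right dot_diff_right dual_bases_def mult.assoc)
  then show ?thesis by blast
qed

definition indep_forms :: "nat \<Rightarrow> nat \<Rightarrow> (nat \<Rightarrow> nat \<Rightarrow> real) \<Rightarrow> bool" where
  "indep_forms n m f \<longleftrightarrow>
     (\<forall>a. (\<forall>i<n. (\<Sum>r<m. a r * f r i) = 0) \<longrightarrow> (\<forall>r<m. a r = 0))"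

text \<open>Steinitz exchange in the dual space. The bound \<open>m \<le> n\<close> later limits the
  size of orthogonal families.\<close>

lemma indep_forms_extend:
  assumes "indep_forms n m f"
  shows "m \<le> n \<and> (\<exists>P A. dual_bases n P A \<and> (\<forall>r<m. P r = f r))"
  using assms
proof (induction m)
  case 0
  have "dual_bases n unit_fun unit_fun"
    by (auto simp: dual_bases_def dot_unit) (auto simp: unit_fun_def)
  then show ?case by blast
next
  case (Suc m)
  have "indep_forms n m f"
    unfolding indep_forms_def
  proof (intro allI impI)
    fix a r
    assume a: "\<forall>i<n. (\<Sum>r<m. a r * f r i) = 0" and "r < m"
    have "\<forall>i<n. (\<Sum>r<Suc m. (a(m := 0)) r * f r i) = 0" using a by simp
    then have "\<forall>r<Suc m. (a(m := 0)) r = 0" using Suc.prems unfolding indep_forms_def by blast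
    with \<open>r < m\<close> show "a r = 0" by (auto dest: spec[of _ r])
  qed
  then obtain P A where m: "m \<le> n" and PA: "dual_bases n P A" "\<forall>r<m. P r = f r"
    using Suc.IH by blast
  \<comment> \<open>Otherwise the expansion of \<open>f m\<close> would involve only the rows
    \<open>f r\<close> with \<open>r < m\<close>; together with the coefficient -1 for
    \<open>f m\<close> itself this is a nontrivial relation.\<close>
  have "\<exists>u. m \<le> u \<and> u < n \<and> dot n (f m) (A u) \<noteq> 0"
  proof (rule ccontr)
    assume *: "\<not> ?thesis"
    define a where "a r = (if r = m then -1 else dot n (f m) (A r))" for r
    have "(\<Sum>r<Suc m. a r * f r i) = 0" if "i < n" for i
    proof -
      have "f m i = (\<Sum>r<n. dot n (f m) (A r) * P r i)"
        using dual_bases_expand[OF PA(1) that] .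
      also have "\<dots> = (\<Sum>r<m. dot n (f m) (A r) * P r i)"
        using * m by (intro sum.mono_neutral_right) auto
      also have "\<dots> = (\<Sum>r<m. a r * f r i)"
        using PA(2) by (intro sum.cong) (auto simp: a_def)
      finally show ?thesis by (simp add: a_def)
    qed
    then have "\<forall>r<Suc m. a r = 0"
      using Suc.prems unfolding indep_forms_def by blast
    then show False by (auto simp: a_def)
  qed
  then obtain u where u: "m \<le> u" "u < n" "dot n (f m) (A u) \<noteq> 0" by blast
  \<comment> \<open>Both swapped positions are at least \<open>m\<close>, so the rows already in
    place stay there.\<close>
  let ?t = "Transposition.transpose m u"
  obtain A' where "dual_bases n ((P \<circ> ?t)(m := f m)) A'"
    using dual_bases_replace[OF dual_bases_swap[OF PA(1), of m u], of m "f m"] u by auto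
  moreover have "\<forall>r<Suc m. ((P \<circ> ?t)(m := f m)) r = f r"
    using PA(2) u(1) by (auto simp: Transposition.transpose_def)
  ultimately show ?case using u(1,2) by (intro conjI) (auto intro!: exI)
qed

section \<open>Hyperbolic quadratic forms\<close>

definition bil :: "nat \<Rightarrow> (nat \<Rightarrow> nat \<Rightarrow> 'a::comm_ring_1) \<Rightarrow> (nat \<Rightarrow> 'a) \<Rightarrow> (nat \<Rightarrow> 'a) \<Rightarrow> 'a" where
  "bil n N x y = dot n x (\<lambda>i. dot n (N i) y)"

lemma bil_add_left: "bil n N (\<lambda>i. x i + x' i) y = bil n N x y + bil n N x' y"
  and bil_add_right: "bil n N x (\<lambda>i. y i + y' i) = bil n N x y + bil n N x y'"
  and bil_diff_right: "bil n N x (\<lambda>i. y i - y' i) = bil n N x y - bil n N x y'"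
  and bil_scale_left: "bil n N (\<lambda>i. c * x i) y = c * bil n N x y"
  and bil_scale_right: "bil n N x (\<lambda>i. c * y i) = c * bil n N x y"
  by (simp_all add: bil_def dot_add_left dot_add_right dot_diff_right dot_scale_left dot_scale_right)

lemma bil_sum_right: "bil n N x (\<lambda>i. \<Sum>r\<in>S. y r i) = (\<Sum>r\<in>S. bil n N x (y r))"
  by (simp add: bil_def dot_sum_right)

lemma bil_commute:
  assumes "\<And>i k. N i k = N k i"
  shows "bil n N x y = bil n N y x"
  unfolding bil_def dot_def sum_distrib_left
  by (subst sum.swap) (simp add: assms[of _ "_ :: nat"] mult_ac)

lemma bil_unit: "i < n \<Longrightarrow> k < n \<Longrightarrow> bil n N (unit_fun i) (unit_fun k) = N i k"
  by (simp add: bil_def dot_unit dot_commute[of n "N i" for i])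

lemma bil_unit_left: "i < n \<Longrightarrow> bil n N (unit_fun i) y = dot n (N i) y"
  by (simp add: bil_def dot_unit)

lemma eval_qf: "eval (qf n M) z = bil n M (\<lambda>i. z $ i) (\<lambda>i. z $ i)"
  unfolding qf_def bil_def dot_def
  by (simp add: eval.hom_simps sum_distrib_left mult_ac)

lemma bil_complex:
  assumes "\<And>i k. i < n \<Longrightarrow> k < n \<Longrightarrow> M i k = c * complex_of_real (N i k)"
  shows "bil n M (\<lambda>i. of_real (x i)) (\<lambda>i. of_real (y i)) = c * of_real (bil n N x y)"
  unfolding bil_def dot_def sum_distrib_left of_real_sum
  by (intro sum.cong refl) (simp add: assms)

text \<open>The restriction to the line x + t e, divided by \<open>c = - H e e\<close>, is q + 2 b t
  - t^2 with roots b + s and b - s, where s^2 = b^2 + q. Both roots are real, so b, s and then q are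
  real, and b^2 + q = s^2 is nonnegative. In particular the form is a complex multiple of a real
  one.\<close>

lemma hyperbolic_real_form:
  assumes M: "\<And>i k. M i k = M k i" and hyp: "hyperbolic n (qf n M)"
  obtains c N e where "c \<noteq> 0" "\<And>i k. (N i k :: real) = N k i"
    "\<And>i k. i < n \<Longrightarrow> k < n \<Longrightarrow> M i k = c * of_real (N i k)"
    "bil n N e e = -1" "\<And>x. bil n N x x + (bil n N x e)\<^sup>2 \<ge> 0"
proof -
  obtain e0 where e0: "hyperbolic_wrt n (qf n M) e0" using hyp by (auto simp: hyperbolic_def)
  define e where "e i = e0 $ i" for i
  let ?C = "\<lambda>x i. complex_of_real (x i)"
  define H where "H x y = bil n M (?C x) (?C y)" for x y
  have Hsym: "H x y = H y x" for x y unfolding H_def using M by (rule bil_commute)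
  have real_roots: "t \<in> \<real>" if "H x x + 2 * t * H x e + t\<^sup>2 * H e e = 0" for x t
  proof -
    let ?z = "map_vec complex_of_real (vec n x) + t \<cdot>\<^sub>v map_vec complex_of_real e0"
    have "e0 \<in> carrier_vec n" using e0 by (simp add: hyperbolic_wrt_def)
    then have "eval (qf n M) ?z = bil n M (\<lambda>i. ?C x i + t * ?C e i) (\<lambda>i. ?C x i + t * ?C e i)"
      unfolding eval_qf bil_def by (intro dot_cong) (auto simp: e_def)
    also have "\<dots> = H x x + 2 * t * H x e + t\<^sup>2 * H e e"
      using Hsym[of e x]
      by (simp add: bil_add_left bil_add_right bil_scale_left bil_scale_right H_def[symmetric]
          power2_eq_square algebra_simps)
    finally have "eval (qf n M) ?z = 0" using that by simp
    then show ?thesis using e0 unfolding hyperbolic_wrt_def by (meson vec_carrier)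
  qed
  define c where "c = - H e e"
  have "H (\<lambda>_. 0) y = 0" for y by (simp add: H_def bil_def dot_def)
  \<comment> \<open>At \<open>x = 0\<close> the restriction is \<open>t\<^sup>2 * H e e\<close>; if
    \<open>H e e\<close> were 0, the root \<open>\<i>\<close> would have to be real.\<close>
  then have "c \<noteq> 0" using real_roots[of "\<lambda>_. 0" \<i>] by (auto simp: c_def complex_is_Real_iff)
  define q where "q x = H x x / c" for x
  define b where "b x = H x e / c" for x
  have disc: "q x \<in> \<real> \<and> b x \<in> \<real> \<and> Re (q x + (b x)\<^sup>2) \<ge> 0" for x
  proof -
    define s where "s = csqrt ((b x)\<^sup>2 + q x)"
    have s2: "s\<^sup>2 = (b x)\<^sup>2 + q x" by (simp add: s_def)
    have root: "t \<in> \<real>" if "q x + 2 * t * b x - t\<^sup>2 = 0" for t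
    proof (rule real_roots[of x])
      have "H x x = c * q x" "H x e = c * b x" "H e e = - c"
        using \<open>c \<noteq> 0\<close> by (simp_all add: q_def b_def c_def)
      then have "H x x + 2 * t * H x e + t\<^sup>2 * H e e = c * (q x + 2 * t * b x - t\<^sup>2)"
        by (simp add: algebra_simps)
      then show "H x x + 2 * t * H x e + t\<^sup>2 * H e e = 0" using that by simp
    qed
    have "b x + s \<in> \<real>" "b x - s \<in> \<real>"
      using s2 by (auto intro!: root simp: power2_eq_square algebra_simps)
    then have "Im (b x) = 0" "Im s = 0" by (auto simp: complex_is_Real_iff)
    then have "b x \<in> \<real>" "s \<in> \<real>" by (auto simp: complex_is_Real_iff)
    moreover have "q x = s\<^sup>2 - (b x)\<^sup>2" using s2 by simp
    moreover have "Re (s\<^sup>2) \<ge> 0" using \<open>Im s = 0\<close> by (simp add: power2_eq_square)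
    ultimately show ?thesis by simp
  qed
  define N where "N i k = Re (M i k / c)" for i k
  have MN: "M i k = c * of_real (N i k)" if "i < n" "k < n" for i k
  proof -
    define u :: "nat \<Rightarrow> nat \<Rightarrow> real" where "u = unit_fun"
    have Cu: "?C (u i) = unit_fun i" for i by (auto simp: unit_fun_def u_def)
    have Hu: "H (u i) (u k) = M i k" unfolding H_def Cu using that by (rule bil_unit)
    \<comment> \<open>So far only the diagonal values q(x) are known to be real; polarisation
      carries this over to the entries of \<open>M\<close>.\<close>
    have "H (\<lambda>l. u i l + u k l) (\<lambda>l. u i l + u k l) = H (u i) (u i) + 2 * H (u i) (u k) + H (u k) (u k)"
      using Hsym[of "u k" "u i"]
      by (simp add: H_def bil_add_left bil_add_right)
    with Hu have "H (\<lambda>l. u i l + u k l) (\<lambda>l. u i l + u k l) = H (u i) (u i) + 2 * M i k + H (u k) (u k)"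
      by simp
    then have "M i k / c = (q (\<lambda>l. u i l + u k l) - q (u i) - q (u k)) / 2"
      by (simp add: q_def add_divide_distrib)
    moreover have "\<dots> \<in> \<real>" using disc by (intro Reals_divide Reals_diff) auto
    ultimately have "M i k / c \<in> \<real>" by (simp only:)
    then have "M i k / c = of_real (N i k)" unfolding N_def by (simp only: of_real_Re)
    then show ?thesis using \<open>c \<noteq> 0\<close> by (simp add: field_simps)
  qed
  have HN: "H x y = c * of_real (bil n N x y)" for x y
    unfolding H_def using MN by (rule bil_complex)
  have "c * of_real (bil n N e e) = c * (-1)" using HN[of e e] by (simp add: c_def)
  then have ee: "bil n N e e = -1" using \<open>c \<noteq> 0\<close>
    by (metis mult_left_cancel of_real_1 of_real_eq_iff of_real_minus)
  have "bil n N x x + (bil n N x e)\<^sup>2 \<ge> 0" for x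
    using disc[of x] \<open>c \<noteq> 0\<close> by (simp add: q_def b_def HN flip: of_real_power)
  then show thesis using that[OF \<open>c \<noteq> 0\<close> _ MN ee] M by (simp add: N_def)
qed

text \<open>The negative direction carries the last index \<open>j\<close>, in agreement with the
  sign of the square of \<open>Var j\<close> in the normal form.\<close>

definition signature :: "nat \<Rightarrow> nat \<Rightarrow> real" where
  "signature j r = (if r = j then -1 else 1)"

definition orthogonal_family :: "nat \<Rightarrow> (nat \<Rightarrow> nat \<Rightarrow> real) \<Rightarrow> nat \<Rightarrow> (nat \<Rightarrow> nat \<Rightarrow> real) \<Rightarrow> bool" where
  "orthogonal_family n N j v \<longleftrightarrow>
     (\<forall>r\<le>j. \<forall>s\<le>j. bil n N (v r) (v s) = (if r = s then signature j r else 0))"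

text \<open>Pairing a vanishing combination with \<open>v s\<close> isolates \<open>a s\<close> up
  to sign, since all other forms, also those beyond index \<open>j\<close>, vanish on
  \<open>v s\<close>. Only the forms above \<open>j\<close> remain; in the applications there are
  none, one or two of them.\<close>

lemma indep_formsI:
  assumes "j < m"
    and diag: "\<And>r s. r < m \<Longrightarrow> s \<le> j \<Longrightarrow> dot n (f r) (v s) = (if r = s then signature j s else 0)"
    and rest: "\<And>a. (\<And>i. i < n \<Longrightarrow> (\<Sum>r\<in>{j<..<m}. a r * f r i) = 0) \<Longrightarrow> \<forall>r\<in>{j<..<m}. a r = 0"
  shows "indep_forms n m f"
  unfolding indep_forms_def
proof (rule allI, rule impI)
  fix a assume a: "\<forall>i<n. (\<Sum>r<m. a r * f r i) = 0"
  have le: "a s = 0" if "s \<le> j" for s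
  proof -
    have "0 = dot n (\<lambda>i. \<Sum>r<m. a r * f r i) (v s)" using a by (simp add: dot_def)
    also have "\<dots> = (\<Sum>r<m. a r * dot n (f r) (v s))"
      by (simp add: dot_sum_left dot_scale_left)
    also have "\<dots> = (\<Sum>r<m. if r = s then a r * signature j s else 0)"
      using diag that by (intro sum.cong) auto
    also have "\<dots> = a s * signature j s" using that assms(1) by simp
    finally show ?thesis by (auto simp: signature_def split: if_splits)
  qed
  have "(\<Sum>r\<in>{j<..<m}. a r * f r i) = 0" if "i < n" for i
  proof -
    have "(\<Sum>r<m. a r * f r i) = (\<Sum>r\<in>{j<..<m}. a r * f r i)"
      by (rule sum.mono_neutral_right) (auto simp: le)
    with a that show ?thesis by simp
  qed
  then have "\<forall>r\<in>{j<..<m}. a r = 0" by (rule rest)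
  then show "\<forall>r<m. a r = 0" using le by (metis greaterThanLessThan_iff not_le)
qed

text \<open>A vector orthogonal to the family is orthogonal to \<open>e\<close>, so
  \<open>psd\<close> makes its square nonnegative. A positive square could be normalised to 1 and
  would enlarge the family; hence it is 0, and polarisation extends this to pairs.\<close>

lemma maximal_orthogonal_family:
  assumes N: "\<And>i k. (N i k :: real) = N k i" and ee: "bil n N e e = -1"
    and psd: "\<And>x. bil n N x x + (bil n N x e)\<^sup>2 \<ge> 0"
  obtains j v where "orthogonal_family n N j v"
    "\<And>x y. (\<And>r. r \<le> j \<Longrightarrow> bil n N x (v r) = 0) \<Longrightarrow> (\<And>r. r \<le> j \<Longrightarrow> bil n N y (v r) = 0)
       \<Longrightarrow> bil n N x y = 0"
proof -
  let ?B = "bil n N"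
  have sym: "?B x y = ?B y x" for x y using N by (rule bil_commute)
  define S where "S j \<longleftrightarrow> (\<exists>v. orthogonal_family n N j v \<and> v j = e)" for j
  \<comment> \<open>The functionals given by the \<open>j + 1\<close> members are independent
    because the members themselves separate them.\<close>
  have bound: "j \<le> n" if "S j" for j
  proof -
    obtain v where "orthogonal_family n N j v" using \<open>S j\<close> by (auto simp: S_def)
    then have "indep_forms n (Suc j) (\<lambda>r i. dot n (N i) (v r))"
      by (intro indep_formsI[of j _ _ _ v])
        (auto simp: orthogonal_family_def bil_def dot_commute[of n _ "v _"])
    then show ?thesis using indep_forms_extend by fastforce
  qed
  have "S 0" using ee by (auto simp: S_def orthogonal_family_def signature_def intro: exI[of _ "\<lambda>_. e"])
  then obtain j where j: "S j" and max: "\<And>k. S k \<Longrightarrow> k \<le> j"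
    using GreatestI_nat[of S 0 n] Greatest_le_nat[of S _ n] bound by metis
  obtain v where v: "orthogonal_family n N j v" "v j = e" using j by (auto simp: S_def)
  have null: "?B x x = 0" if x: "\<And>r. r \<le> j \<Longrightarrow> ?B x (v r) = 0" for x
  proof (rule ccontr)
    assume "?B x x \<noteq> 0"
    then have pos: "?B x x > 0" using psd[of x] x[of j] v(2) by simp
    define k where "k = 1 / sqrt (?B x x)"
    define u where "u = (\<lambda>i. k * x i)"
    have "k * k * ?B x x = 1" using pos by (simp add: k_def)
    then have uu: "?B u u = 1" by (simp add: u_def bil_scale_left bil_scale_right mult.assoc)
    have uv: "?B u (v r) = 0" "?B (v r) u = 0" if "r \<le> j" for r
      using x[OF that] sym[of "v r" u] by (auto simp: u_def bil_scale_left)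
    \<comment> \<open>The new vector takes index \<open>j\<close>, and \<open>e\<close> moves up to
      \<open>Suc j\<close>, the index at which the new signature is negative.\<close>
    define v' where "v' r = (if r < j then v r else if r = j then u else e)" for r
    have old: "?B (v r) (v s) = (if r = s then 1 else 0)" if "r < j" "s < j" for r s
      using v that by (auto simp: orthogonal_family_def signature_def)
    have ve: "?B (v r) e = 0" "?B e (v r) = 0" if "r < j" for r
      using v that by (auto simp: orthogonal_family_def)
    have ue: "?B u e = 0" "?B e u = 0" using uv[of j] v(2) by auto
    have "?B (v' r) (v' s) = (if r = s then signature (Suc j) r else 0)" if "r \<le> Suc j" "s \<le> Suc j" for r s
    proof -
      have "r < j \<or> r = j \<or> r = Suc j" "s < j \<or> s = j \<or> s = Suc j" using that by auto
      then show ?thesis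
        by (elim disjE) (simp_all add: v'_def signature_def old ve ue uv uu ee)
    qed
    then have "S (Suc j)" unfolding S_def orthogonal_family_def by (intro exI[of _ v']) (simp add: v'_def)
    then show False using max by fastforce
  qed
  show thesis
  proof (rule that[OF v(1)])
    fix x y assume x: "\<And>r. r \<le> j \<Longrightarrow> ?B x (v r) = 0" and y: "\<And>r. r \<le> j \<Longrightarrow> ?B y (v r) = 0"
    have "?B (\<lambda>i. x i + y i) (\<lambda>i. x i + y i) = 0"
      by (rule null) (simp add: bil_add_left x y)
    then show "?B x y = 0" using null[OF x] null[OF y] sym[of y x]
      by (simp add: bil_add_left bil_add_right)
  qed
qed

text \<open>\<open>w x\<close> is \<open>x\<close> minus its orthogonal projection to the span of
  the family, so the form vanishes on \<open>w x\<close> and \<open>w y\<close>. The signs serve as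
  coefficients because 1 and -1 are their own inverses.\<close>

lemma orthogonal_expansion:
  assumes N: "\<And>i k. (N i k :: real) = N k i" and v: "orthogonal_family n N j v"
    and null: "\<And>x y. (\<And>r. r \<le> j \<Longrightarrow> bil n N x (v r) = 0) \<Longrightarrow> (\<And>r. r \<le> j \<Longrightarrow> bil n N y (v r) = 0)
       \<Longrightarrow> bil n N x y = 0"
  shows "bil n N x y = (\<Sum>r\<le>j. signature j r * bil n N x (v r) * bil n N y (v r))"
proof -
  let ?B = "bil n N"
  have sym: "?B x y = ?B y x" for x y using N by (rule bil_commute)
  define w where "w x = (\<lambda>i. x i - (\<Sum>r\<le>j. (signature j r * ?B x (v r)) * v r i))" for x
  have exp: "?B y (w x) = ?B y x - (\<Sum>r\<le>j. signature j r * ?B x (v r) * ?B y (v r))" for x y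
    by (simp add: w_def bil_diff_right bil_sum_right bil_scale_right)
  have wv: "?B (w x) (v s) = 0" if "s \<le> j" for x s
  proof -
    have "(\<Sum>r\<le>j. signature j r * ?B x (v r) * ?B (v s) (v r)) = (\<Sum>r\<le>j. if r = s then ?B x (v r) else 0)"
      using v that by (intro sum.cong) (auto simp: orthogonal_family_def signature_def)
    then show ?thesis using exp[of "v s" x] that sym[of "w x" "v s"] sym[of x "v s"] by simp
  qed
  have "0 = ?B (w x) (w y)" by (metis null wv)
  also have "\<dots> = ?B (w x) y" using wv by (simp add: exp)
  also have "\<dots> = ?B x y - (\<Sum>r\<le>j. signature j r * ?B x (v r) * ?B y (v r))"
    using exp[of y x] sym[of "w x" y] sym[of x y] by simp
  finally show ?thesis by simp
qed

section \<open>Normal forms\<close>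

abbreviation rlin :: "nat \<Rightarrow> (nat \<Rightarrow> real) \<Rightarrow> cpoly" where
  "rlin n a \<equiv> lin n (\<lambda>i. complex_of_real (a i))"

text \<open>One formula for both families: \<open>j = 0\<close> yields the negative of a form of the
  first family, and the sign is absorbed into the constant factor.\<close>

definition nf :: "nat \<Rightarrow> complex \<Rightarrow> complex \<Rightarrow> complex \<Rightarrow> cpoly" where
  "nf j \<alpha> r \<gamma> = (\<Sum>i<j. Var i ^ 2) - Var j ^ 2 + Const \<alpha> * Var (j + 1) + Const r * Var (j + 2)
     + Const \<gamma>"

lemma qf_sum: "qf n (\<lambda>i k. \<Sum>r\<in>S. M r i k) = (\<Sum>r\<in>S. qf n (M r))"
proof (induction S rule: infinite_finite_induct)
  case (insert x S)
  then show ?case by (simp add: qf_add)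
qed (simp_all add: qf_def)

lemma qf_scale: "qf n (\<lambda>i k. c * M i k) = Const c * qf n M"
  by (simp add: qf_def Const_mult sum_distrib_left mult.assoc)

lemma qf_cong: "(\<And>i k. i < n \<Longrightarrow> k < n \<Longrightarrow> M i k = N i k) \<Longrightarrow> qf n M = qf n N"
  by (simp add: qf_def)

lemma lin_square: "(lin n a)\<^sup>2 = qf n (\<lambda>i k. a i * a k)"
  by (simp add: lin_def qf_def power2_eq_square sum_product Const_mult mult_ac)

lemma dot_of_real: "dot n (\<lambda>i. complex_of_real (a i)) (\<lambda>i. complex_of_real (x i)) = of_real (dot n a x)"
  by (simp add: dot_def)

lemma complete_square:
  "Const s * (L + Const (d / 2))\<^sup>2 = Const s * L\<^sup>2 + Const (s * d) * L + Const (s * d\<^sup>2 / 4)"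
proof -
  have "Const (d / 2) + Const (d / 2) = Const d" by (simp add: Const_add[symmetric])
  moreover have "Const (s * d\<^sup>2 / 4) = Const s * Const (d / 2) * Const (d / 2)"
    by (simp add: Const_mult[symmetric] power2_eq_square mult.assoc)
  moreover have "Const s * (L + Const (d / 2))\<^sup>2
      = Const s * L\<^sup>2 + Const s * (Const (d / 2) + Const (d / 2)) * L + Const s * Const (d / 2) * Const (d / 2)"
    by (simp only: power2_eq_square) (simp only: algebra_simps)
  ultimately show ?thesis by (simp add: Const_mult)
qed

text \<open>Along the \<open>v r\<close> the linear part is absorbed by completing squares. That the
  rest \<open>\<mu>\<close> vanishes on every \<open>v s\<close> is what later makes it independent
  of the forms \<open>f r\<close>.\<close>

lemma diagonal_decomposition:
  assumes "indets p \<subseteq> {..<n}" "total_degree p = 2" "hyperbolic n (initial_form p)"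
  obtains j c f v d \<mu> \<gamma> where "c \<noteq> 0"
    "\<And>r s. r \<le> j \<Longrightarrow> s \<le> j \<Longrightarrow> dot n (f r) (v s) = (if r = s then signature j s else 0)"
    "\<And>s. s \<le> j \<Longrightarrow> dot n \<mu> (\<lambda>i. complex_of_real (v s i)) = 0"
    "p = Const c * ((\<Sum>r\<le>j. Const (of_real (signature j r)) * (rlin n (f r) + Const (d r))\<^sup>2)
       + lin n \<mu> + Const \<gamma>)"
proof -
  obtain M l k where M: "\<And>i k. M i k = M k i" "initial_form p = qf n M"
    and p: "p = qf n M + lin n l + Const k"
    using quadratic_decomposition[OF assms(1,2)] by metis
  obtain c N e where c: "c \<noteq> 0" and N: "\<And>i k. (N i k :: real) = N k i"
    and MN: "\<And>i k. i < n \<Longrightarrow> k < n \<Longrightarrow> M i k = c * of_real (N i k)"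
    and e: "bil n N e e = -1" "\<And>x. bil n N x x + (bil n N x e)\<^sup>2 \<ge> 0"
    using hyperbolic_real_form[of M n] M assms(3) by metis
  obtain j v where v: "orthogonal_family n N j v"
    and null: "\<And>x y. (\<And>r. r \<le> j \<Longrightarrow> bil n N x (v r) = 0) \<Longrightarrow> (\<And>r. r \<le> j \<Longrightarrow> bil n N y (v r) = 0)
       \<Longrightarrow> bil n N x y = 0"
    using maximal_orthogonal_family[OF N e] by metis
  let ?C = "\<lambda>x i. complex_of_real (x i)"
  let ?s = "\<lambda>r. complex_of_real (signature j r)"
  define f where "f r i = dot n (N i) (v r)" for r i
  define l' where "l' i = l i / c" for i
  define d where "d r = dot n l' (?C (v r))" for r
  \<comment> \<open>On \<open>v s\<close> the subtracted sum takes the value \<open>d s\<close>, the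
    sign occurring squared, so \<open>\<mu>\<close> vanishes there.\<close>
  define \<mu> where "\<mu> i = l' i - (\<Sum>r\<le>j. ?s r * d r * of_real (f r i))" for i
  define \<gamma> where "\<gamma> = k / c - (\<Sum>r\<le>j. ?s r * (d r)\<^sup>2 / 4)"
  have fv: "dot n (f r) (v s) = (if r = s then signature j s else 0)" if "r \<le> j" "s \<le> j" for r s
  proof -
    have "f r = (\<lambda>i. dot n (N i) (v r))" by (simp add: fun_eq_iff f_def)
    then have "dot n (f r) (v s) = bil n N (v s) (v r)" by (simp add: bil_def dot_commute[of n "v s"])
    then show ?thesis using v that by (auto simp: orthogonal_family_def)
  qed
  have Nf: "N a b = (\<Sum>r\<le>j. signature j r * (f r a * f r b))" if "a < n" "b < n" for a b
    using orthogonal_expansion[OF N v null, of "unit_fun a" "unit_fun b"] that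
    by (simp add: bil_unit_left dot_unit_right f_def mult.assoc)
  have "qf n M = qf n (\<lambda>a b. c * (\<Sum>r\<le>j. ?s r * (of_real (f r a) * of_real (f r b))))"
    by (rule qf_cong) (simp add: MN Nf)
  then have qf: "qf n M = Const c * (\<Sum>r\<le>j. Const (?s r) * (rlin n (f r))\<^sup>2)"
    by (simp only: qf_scale qf_sum lin_square)
  have "lin n l' = lin n (\<lambda>i. (\<Sum>r\<le>j. ?s r * d r * of_real (f r i)) + \<mu> i)"
    by (simp add: \<mu>_def)
  then have lin': "lin n l' = (\<Sum>r\<le>j. Const (?s r * d r) * rlin n (f r)) + lin n \<mu>"
    by (simp only: lin_add lin_sum lin_scale)
  have lin: "lin n l = Const c * lin n l'"
    using c by (simp add: l'_def flip: lin_scale)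
  have k: "Const k = Const c * ((\<Sum>r\<le>j. Const (?s r * (d r)\<^sup>2 / 4)) + Const \<gamma>)"
    using c by (simp add: \<gamma>_def flip: Const_mult Const_add Const_sum)
  have "p = Const c * ((\<Sum>r\<le>j. Const (?s r) * (rlin n (f r) + Const (d r / 2))\<^sup>2)
       + lin n \<mu> + Const \<gamma>)"
    unfolding complete_square sum.distrib p qf lin k lin' by (simp add: distrib_left)
  moreover have "dot n \<mu> (?C (v s)) = 0" if "s \<le> j" for s
  proof -
    have "dot n (\<lambda>i. \<mu> i + (\<Sum>r\<le>j. ?s r * d r * of_real (f r i))) (?C (v s))
       = dot n \<mu> (?C (v s)) + (\<Sum>r\<le>j. ?s r * d r * of_real (dot n (f r) (v s)))"
      by (simp only: dot_add_left dot_sum_left dot_scale_left dot_of_real)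
    also have "(\<Sum>r\<le>j. ?s r * d r * of_real (dot n (f r) (v s))) = (\<Sum>r\<le>j. if r = s then d r else 0)"
      using that by (intro sum.cong) (auto simp: fv signature_def)
    also have "\<dots> = d s" using that by simp
    also have "(\<lambda>i. \<mu> i + (\<Sum>r\<le>j. ?s r * d r * of_real (f r i))) = l'"
      by (simp add: \<mu>_def)
    finally show ?thesis by (simp add: d_def)
  qed
  ultimately show thesis using c fv
    by (intro that[where c = c and j = j and f = f and v = v and \<mu> = \<mu>
          and d = "\<lambda>r. d r / 2" and \<gamma> = \<gamma>]) auto
qed

lemma act_forms:
  assumes "dual_bases n P A"
  obtains g where "g \<in> G n" "\<And>r. r < n \<Longrightarrow> act n g (rlin n (P r) + Const (d r)) = Var r"
proof -
  \<comment> \<open>The matrix with columns \<open>A s\<close> turns the form \<open>P r\<close>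
    into \<open>Var r\<close>; on \<open>b\<close> that form takes the value \<open>- d r\<close>,
    which cancels the constant.\<close>
  define b where "b = vec n (\<lambda>i. - (\<Sum>s<n. of_real (A s i) * d s))"
  define B where "B = mat n n (\<lambda>(i, s). A s i)"
  have "invertible_mat B"
    unfolding invertible_mat_def inverts_mat_def B_def
    using dual_bases_mat[OF assms] by auto
  then have g: "(b, B) \<in> G n" by (simp add: G_def b_def B_def)
  have "act n (b, B) (rlin n (P r) + Const (d r)) = Var r" if "r < n" for r
  proof -
    have PA: "(\<Sum>i<n. complex_of_real (P r i) * of_real (A s i)) = (if s = r then 1 else 0)" if "s < n" for s
    proof -
      have "complex_of_real (\<Sum>i<n. P r i * A s i) = (if s = r then 1 else 0)"
        using assms that \<open>r < n\<close> by (auto simp: dual_bases_def dot_def)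
      then show ?thesis by simp
    qed
    have "(\<Sum>i<n. complex_of_real (P r i) * b $ i)
      = - (\<Sum>s<n. (\<Sum>i<n. complex_of_real (P r i) * of_real (A s i)) * d s)"
      unfolding sum_distrib_right
      by (subst sum.swap) (simp add: b_def sum_distrib_left sum_negf mult.assoc)
    also have "\<dots> = - d r" using sum_lessThan_delta[OF that, of d] by (simp add: PA)
    finally have const: "(\<Sum>i<n. complex_of_real (P r i) * b $ i) = - d r" .
    have "act n (b, B) (rlin n (P r) + Const (d r)) =
      (\<Sum>i<n. Const (of_real (P r i)) * (\<Sum>s<n. Const (of_real (A s i)) * Var s))
      + Const (\<Sum>i<n. complex_of_real (P r i) * b $ i) + Const (d r)"
      unfolding act_def lin_def
      by (simp add: subst.hom_simps distrib_left sum.distrib Const_sum Const_mult B_def)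
    also have "(\<Sum>i<n. Const (of_real (P r i)) * (\<Sum>s<n. Const (of_real (A s i)) * Var s))
      = (\<Sum>s<n. Const (\<Sum>i<n. complex_of_real (P r i) * of_real (A s i)) * Var s)"
      unfolding sum_distrib_left sum_distrib_right Const_sum Const_mult
      by (subst sum.swap) (simp add: mult.assoc)
    also have "\<dots> = Var r"
      using sum_lessThan_delta[OF that, of Var] by (simp add: PA if_distrib[of Const] cong: if_cong)
    finally show ?thesis by (simp add: const Const_uminus)
  qed
  with g that show thesis by blast
qed

text \<open>Treats zero, one or two surviving linear terms at once: a form with index outside
  \<open>{..<m}\<close> has coefficient 0, so its value is irrelevant.\<close>

lemma act_normal_form:
  assumes "indep_forms n m f" "j < m" "\<alpha> = 0 \<or> j + 1 < m" "r = 0 \<or> j + 2 < m"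
    and p: "p = Const c * ((\<Sum>i\<le>j. Const (of_real (signature j i)) * (rlin n (f i) + Const (d i))\<^sup>2)
       + Const \<alpha> * (rlin n (f (j + 1)) + Const (d (j + 1)))
       + Const r * (rlin n (f (j + 2)) + Const (d (j + 2))) + Const \<gamma>)"
  shows "m \<le> n \<and> (\<exists>g\<in>G n. act n g p = Const c * nf j \<alpha> r \<gamma>)"
proof -
  obtain P A where "m \<le> n" and PA: "dual_bases n P A" "\<forall>i<m. P i = f i"
    using indep_forms_extend[OF assms(1)] by blast
  obtain g where g: "g \<in> G n" "\<And>i. i < n \<Longrightarrow> act n g (rlin n (P i) + Const (d i)) = Var i"
    using act_forms[OF PA(1)] by blast
  have V: "act n g (rlin n (f i) + Const (d i)) = Var i" if "i < m" for i
    using g(2)[of i] PA(2) that \<open>m \<le> n\<close> by auto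
  have hom: "act n g (a + b) = act n g a + act n g b" "act n g (a * b) = act n g a * act n g b"
      "act n g (Const x) = Const x" "act n g (a ^ k) = act n g a ^ k"
      "act n g (\<Sum>i\<in>S. h i) = (\<Sum>i\<in>S. act n g (h i))" for a b x k h and S :: "nat set"
    by (simp_all add: act_def subst.hom_simps)
  have "act n g p = Const c * ((\<Sum>i\<le>j. Const (of_real (signature j i)) * Var i ^ 2)
       + Const \<alpha> * act n g (rlin n (f (j + 1)) + Const (d (j + 1)))
       + Const r * act n g (rlin n (f (j + 2)) + Const (d (j + 2))) + Const \<gamma>)"
    unfolding p hom(1)[of "_ + _"] hom(1)[of "_ * _"] hom(1)[of "sum _ _"] hom(2-5)
    using assms(2) by (intro arg_cong2[of _ _ _ _ "(+)"] arg_cong2[of _ _ _ _ "(*)"] sum.cong refl) (simp add: V)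
  moreover have "Const \<alpha> * act n g (rlin n (f (j + 1)) + Const (d (j + 1))) = Const \<alpha> * Var (j + 1)"
    using assms(3) V[of "j + 1"] by auto
  moreover have "Const r * act n g (rlin n (f (j + 2)) + Const (d (j + 2))) = Const r * Var (j + 2)"
    using assms(4) V[of "j + 2"] by auto
  moreover have "(\<Sum>i\<le>j. Const (of_real (signature j i)) * Var i ^ 2) = (\<Sum>i<j. Var i ^ 2) - Var j ^ 2"
    by (simp add: signature_def Const_uminus flip: lessThan_Suc_atMost)
  ultimately have "act n g p = Const c * nf j \<alpha> r \<gamma>" by (simp only: nf_def)
  with g(1) \<open>m \<le> n\<close> show ?thesis by blast
qed

section \<open>Lorentzian geometry\<close>

definition lor :: "nat \<Rightarrow> (nat \<Rightarrow> real) \<Rightarrow> (nat \<Rightarrow> real) \<Rightarrow> real" where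
  "lor j x y = (\<Sum>i<j. x i * y i) - x j * y j"

lemma lor_commute: "lor j x y = lor j y x"
  by (simp add: lor_def mult.commute)

lemma lor_add_left: "lor j (\<lambda>i. x i + x' i) y = lor j x y + lor j x' y"
  and lor_scale_left: "lor j (\<lambda>i. c * x i) y = c * lor j x y"
  by (simp_all add: lor_def sum.distrib sum_distrib_left algebra_simps)

lemma lor_add_right: "lor j y (\<lambda>i. x i + x' i) = lor j y x + lor j y x'"
  and lor_scale_right: "lor j y (\<lambda>i. c * x i) = c * lor j y x"
  by (simp_all add: lor_commute[of j y] lor_add_left lor_scale_left)

lemma lor_cong: "(\<And>i. i \<le> j \<Longrightarrow> x i = x' i) \<Longrightarrow> (\<And>i. i \<le> j \<Longrightarrow> y i = y' i) \<Longrightarrow> lor j x y = lor j x' y'"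
  by (simp add: lor_def)

text \<open>By Lagrange's identity, twice the difference of the two sides is a sum of
  squares.\<close>

lemma sum_Cauchy_Schwarz:
  fixes x y :: "'a \<Rightarrow> real"
  shows "(\<Sum>i\<in>S. x i * y i)\<^sup>2 \<le> (\<Sum>i\<in>S. x i * x i) * (\<Sum>i\<in>S. y i * y i)"
proof -
  have "0 \<le> (\<Sum>i\<in>S. \<Sum>k\<in>S. (x i * y k - x k * y i)\<^sup>2)"
    by (intro sum_nonneg) simp
  also have "\<dots> = (\<Sum>i\<in>S. \<Sum>k\<in>S. (x i * x i) * (y k * y k) + (y i * y i) * (x k * x k)
      - 2 * ((x i * y i) * (x k * y k)))"
    by (intro sum.cong refl) (simp add: power2_eq_square algebra_simps)
  also have "\<dots> = (\<Sum>i\<in>S. \<Sum>k\<in>S. (x i * x i) * (y k * y k))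
      + (\<Sum>i\<in>S. \<Sum>k\<in>S. (y i * y i) * (x k * x k)) - 2 * (\<Sum>i\<in>S. \<Sum>k\<in>S. (x i * y i) * (x k * y k))"
    by (simp only: sum.distrib sum_subtractf sum_distrib_left)
  also have "\<dots> = 2 * ((\<Sum>i\<in>S. x i * x i) * (\<Sum>i\<in>S. y i * y i)) - 2 * (\<Sum>i\<in>S. x i * y i)\<^sup>2"
    by (simp only: sum_product[symmetric] power2_eq_square) simp
  finally show ?thesis by simp
qed

text \<open>Orthogonality equates \<open>x j * y j\<close> with the spatial product, whose square is
  at most \<open>X * Y\<close> by Cauchy-Schwarz. As \<open>X < x j * x j\<close>, this forces
  \<open>y j * y j < Y\<close>.\<close>

lemma timelike_orthogonal:
  assumes x: "lor j x x < 0" and xy: "lor j x y = 0" and i: "i \<le> j" "y i \<noteq> 0"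
  shows "lor j y y > 0"
proof -
  define X where "X = (\<Sum>i<j. x i * x i)"
  define Y where "Y = (\<Sum>i<j. y i * y i)"
  have X: "0 \<le> X" "X < x j * x j" and Y: "0 \<le> Y"
    using x by (auto simp: X_def Y_def lor_def intro!: sum_nonneg)
  have CS: "(x j * y j)\<^sup>2 \<le> X * Y"
    using sum_Cauchy_Schwarz[of x y "{..<j}"] xy by (simp add: X_def Y_def lor_def)
  \<comment> \<open>If the spatial part of \<open>y\<close> vanished, so would
    \<open>x j * y j\<close> and hence \<open>y j\<close>, since \<open>x j\<close> is
    nonzero.\<close>
  have "Y > 0"
  proof (rule ccontr)
    assume "\<not> Y > 0"
    then have "Y = 0" using Y by simp
    then have "y j = 0" using CS X by (auto simp: mult_nonneg_nonneg)
    moreover have "\<forall>i<j. y i = 0"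
      using \<open>Y = 0\<close> by (simp add: Y_def sum_nonneg_eq_0_iff)
    ultimately show False using i by (metis le_neq_implies_less)
  qed
  then have "(x j * x j) * (y j * y j) < (x j * x j) * Y"
    using CS X by (smt (verit) mult_strict_right_mono power2_eq_square mult.assoc mult.left_commute)
  then have "y j * y j < Y" using X by (simp add: mult_less_cancel_left)
  then show ?thesis by (simp add: lor_def Y_def)
qed

text \<open>The component \<open>z\<close> of \<open>x\<close> orthogonal to the timelike
  \<open>y\<close> has nonnegative square; multiplying by the negative number
  \<open>lor j y y\<close> turns this into the claim.\<close>

lemma reversed_Cauchy_Schwarz:
  assumes "lor j y y < 0"
  shows "lor j x x * lor j y y \<le> (lor j x y)\<^sup>2"
proof -
  define k where "k = lor j x y / lor j y y"
  define z where "z = (\<lambda>i. x i + (- k) * y i)"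
  have k: "k * lor j y y = lor j x y" using assms by (simp add: k_def)
  have "lor j y z = 0"
    using k lor_commute[of j y x] by (simp add: z_def lor_add_right lor_scale_right del: mult_minus_left)
  moreover have "lor j z z = 0" if "\<forall>i\<le>j. z i = 0" using that by (simp add: lor_def)
  ultimately have "lor j z z \<ge> 0"
    using timelike_orthogonal[OF assms, of z] by force
  moreover have "lor j z z = lor j x x - 2 * k * lor j x y + k * (k * lor j y y)"
    using lor_commute[of j y x]
    by (simp add: z_def lor_add_left lor_add_right lor_scale_left lor_scale_right algebra_simps
        del: mult_minus_left)
  ultimately have "lor j x x \<ge> k * lor j x y" using k by simp
  then have "lor j x x * lor j y y \<le> k * lor j x y * lor j y y"
    using assms by (simp add: mult_right_mono_neg)
  also have "\<dots> = (lor j x y)\<^sup>2" using k by (simp add: power2_eq_square mult.commute mult.left_commute)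
  finally show ?thesis .
qed

text \<open>The vector \<open>v\<close> lives in the first two coordinates: either the first unit
  vector or the part \<open>(f 0, f 1)\<close> turned by a right angle and normalised. For
  \<open>u = 0\<close> any unit vector serves as \<open>f\<close>.\<close>

lemma orthonormal_pair:
  fixes u :: "nat \<Rightarrow> real"
  assumes "j \<ge> 2" "a \<ge> 0" "a * a = (\<Sum>i<j. u i * u i)"
  obtains f v where "\<And>i. i < j \<Longrightarrow> u i = a * f i" "(\<Sum>i<j. f i * f i) = 1" "(\<Sum>i<j. v i * v i) = 1"
    "(\<Sum>i<j. f i * v i) = 0"
proof -
  have two: "(\<Sum>i<j. g i) = g 0 + g 1" if "\<And>i. 1 < i \<Longrightarrow> g i = 0" for g :: "nat \<Rightarrow> real"
  proof -
    have "(\<Sum>i<j. g i) = (\<Sum>i\<in>{0, 1}. g i)"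
      using assms(1) by (intro sum.mono_neutral_right) (auto intro!: that)
    then show ?thesis by simp
  qed
  have orth: "\<exists>v. (\<Sum>i<j. v i * v i) = 1 \<and> (\<Sum>i<j. f i * v i) = 0" for f :: "nat \<Rightarrow> real"
  proof (cases "f 0 = 0 \<and> f 1 = 0")
    case True
    let ?v = "\<lambda>i::nat. if i = 0 then 1 else (0::real)"
    have "(\<Sum>i<j. ?v i * ?v i) = 1" by (subst two) auto
    moreover have "(\<Sum>i<j. f i * ?v i) = 0" using True by (subst two) auto
    ultimately show ?thesis by (intro exI[of _ ?v] conjI)
  next
    case False
    define h where "h = sqrt (f 0 * f 0 + f 1 * f 1)"
    have pos: "f 0 * f 0 + f 1 * f 1 > 0" using False by (simp add: sum_squares_gt_zero_iff)
    then have h: "h * h = f 0 * f 0 + f 1 * f 1" by (simp add: h_def)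
    then have h0: "h \<noteq> 0" using pos by auto
    let ?v = "\<lambda>i::nat. if i = 0 then - f 1 / h else if i = 1 then f 0 / h else 0"
    have "(\<Sum>i<j. ?v i * ?v i) = ?v 0 * ?v 0 + ?v 1 * ?v 1" by (rule two) auto
    also have "\<dots> = (f 0 * f 0 + f 1 * f 1) / (h * h)" by (simp add: add_divide_distrib)
    also have "\<dots> = 1" by (metis h h0 divide_self mult_eq_0_iff)
    finally have "(\<Sum>i<j. ?v i * ?v i) = 1" .
    moreover have "(\<Sum>i<j. f i * ?v i) = 0" by (subst two) auto
    ultimately show ?thesis by (intro exI[of _ ?v] conjI)
  qed
  have "\<exists>f. (\<forall>i<j. u i = a * f i) \<and> (\<Sum>i<j. f i * f i) = 1"
  proof (cases "a = 0")
    case True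
    then have "\<forall>i<j. u i = 0" using assms(3) by (simp add: sum_nonneg_eq_0_iff)
    moreover have "(\<Sum>i<j. (if i = 0 then 1 else 0) * (if i = 0 then 1 else (0::real))) = 1"
      by (subst two) auto
    ultimately show ?thesis using True by (intro exI[of _ "\<lambda>i. if i = 0 then 1 else 0"]) simp
  next
    case False
    have "(\<Sum>i<j. u i / a * (u i / a)) = (\<Sum>i<j. u i * u i) / (a * a)"
      by (simp add: sum_divide_distrib)
    also have "\<dots> = 1" using False by (simp flip: assms(3))
    finally show ?thesis using False by (intro exI[of _ "\<lambda>i. u i / a"]) simp
  qed
  then obtain f where "\<forall>i<j. u i = a * f i" "(\<Sum>i<j. f i * f i) = 1" by blast
  moreover obtain v where "(\<Sum>i<j. v i * v i) = 1" "(\<Sum>i<j. f i * v i) = 0"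
    using orth[of f] by blast
  ultimately show thesis using that[of f v] by simp
qed

text \<open>The component of \<open>x\<close> along \<open>v\<close> adds \<open>k * k\<close> to
  \<open>lor j x x\<close> and nothing to \<open>lor j x y\<close>. It makes up the deficit, so the
  quadratic condition on \<open>(s, t)\<close> need only be an inequality. In this plane
  \<open>y\<close> has coordinates \<open>(a, y j)\<close>.\<close>

lemma lor_solve:
  assumes "j \<ge> 2" "a \<ge> 0" "a * a = (\<Sum>i<j. y i * y i)" and "a * s - y j * t = d" "s * s - t * t \<le> c"
  shows "\<exists>x. lor j x x = c \<and> lor j x y = d"
proof -
  obtain f v where f: "\<And>i. i < j \<Longrightarrow> y i = a * f i" "(\<Sum>i<j. f i * f i) = 1" "(\<Sum>i<j. v i * v i) = 1"
    "(\<Sum>i<j. f i * v i) = 0"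
    by (rule orthonormal_pair[OF assms(1-3)], rule that)
  define k where "k = sqrt (c - (s * s - t * t))"
  have k: "k * k = c - (s * s - t * t)" using assms(5) by (simp add: k_def)
  define x where "x i = (if i < j then s * f i + k * v i else t)" for i
  have "(\<Sum>i<j. x i * x i) = (\<Sum>i<j. s * s * (f i * f i) + 2 * s * k * (f i * v i) + k * k * (v i * v i))"
    by (intro sum.cong) (auto simp: x_def algebra_simps)
  also have "\<dots> = s * s + k * k"
    using f by (simp add: sum.distrib flip: sum_distrib_left)
  finally have xx: "(\<Sum>i<j. x i * x i) = s * s + k * k" .
  have "(\<Sum>i<j. x i * y i) = (\<Sum>i<j. a * s * (f i * f i) + a * k * (f i * v i))"
    using f(1) by (intro sum.cong) (auto simp: x_def algebra_simps)
  also have "\<dots> = a * s"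
    using f by (simp add: sum.distrib flip: sum_distrib_left)
  finally have "(\<Sum>i<j. x i * y i) = a * s" .
  with xx k assms(4) have "lor j x x = c \<and> lor j x y = d"
    by (simp add: lor_def x_def[of j] mult.commute)
  then show ?thesis by blast
qed

section \<open>Imaginary projections\<close>

lemma imag_proj_iff:
  "y \<in> imag_proj n q \<longleftrightarrow> y \<in> carrier_vec n \<and> (\<exists>x. eval q (vec n (\<lambda>i. Complex (x i) (y $ i))) = 0)"
proof
  assume "y \<in> imag_proj n q"
  then obtain z where z: "z \<in> carrier_vec n" "eval q z = 0" "y = map_vec Im z"
    by (auto simp: imag_proj_def variety_def)
  then have "vec n (\<lambda>i. Complex (Re (z $ i)) (y $ i)) = z" by (intro eq_vecI) auto
  with z show "y \<in> carrier_vec n \<and> (\<exists>x. eval q (vec n (\<lambda>i. Complex (x i) (y $ i))) = 0)"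
    by (auto intro!: exI[of _ "\<lambda>i. Re (z $ i)"])
next
  assume "y \<in> carrier_vec n \<and> (\<exists>x. eval q (vec n (\<lambda>i. Complex (x i) (y $ i))) = 0)"
  then obtain x where y: "y \<in> carrier_vec n" "eval q (vec n (\<lambda>i. Complex (x i) (y $ i))) = 0"
    by blast
  show "y \<in> imag_proj n q" unfolding imag_proj_def
  proof (rule image_eqI)
    show "y = map_vec Im (vec n (\<lambda>i. Complex (x i) (y $ i)))"
      using y(1) by (intro eq_vecI) auto
    show "vec n (\<lambda>i. Complex (x i) (y $ i)) \<in> variety n q"
      using y(2) by (simp add: variety_def)
  qed
qed

lemma imag_proj_scale: "c \<noteq> 0 \<Longrightarrow> imag_proj n (Const c * q) = imag_proj n q"
  by (simp add: imag_proj_def variety_def eval.hom_simps)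

lemma eval_nf: "eval (nf j \<alpha> r \<gamma>) z = (\<Sum>i<j. (z $ i)\<^sup>2) - (z $ j)\<^sup>2 + \<alpha> * z $ (j + 1) + r * z $ (j + 2) + \<gamma>"
  by (simp add: nf_def eval.hom_simps)

lemma complex_quadric:
  assumes "j < n"
  shows "(\<Sum>i<j. (vec n (\<lambda>i. Complex (x i) (y $ i)) $ i)\<^sup>2) - (vec n (\<lambda>i. Complex (x i) (y $ i)) $ j)\<^sup>2
    = Complex (lor j x x - lor j (\<lambda>i. y $ i) (\<lambda>i. y $ i)) (2 * lor j x (\<lambda>i. y $ i))"
proof -
  have sq: "(Complex a b)\<^sup>2 = Complex (a * a - b * b) (2 * (a * b))" for a b
    by (simp add: power2_eq_square complex_eq_iff)
  have "(\<Sum>i<j. (vec n (\<lambda>i. Complex (x i) (y $ i)) $ i)\<^sup>2)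
    = (\<Sum>i<j. Complex (x i * x i - y $ i * y $ i) (2 * (x i * y $ i)))"
    using assms by (intro sum.cong) (auto simp: sq)
  then show ?thesis using assms
    by (simp add: sq complex_eq_iff lor_def sum_subtractf sum_distrib_left algebra_simps)
qed

section \<open>Solvability of the real and imaginary equations when no linear term is left\<close>

lemma lor_sol_spacelike:
  assumes "j \<ge> 2"
  shows "(\<exists>x. lor j x x = lor j y y - 1 \<and> lor j x y = 0) \<longleftrightarrow> lor j y y > 0 \<or> (\<forall>i\<le>j. y i = 0)"
proof
  assume "\<exists>x. lor j x x = lor j y y - 1 \<and> lor j x y = 0"
  then obtain x where x: "lor j x x = lor j y y - 1" "lor j x y = 0" by blast
  \<comment> \<open>If \<open>lor j y y \<le> 0\<close>, then \<open>x\<close> is timelike, and a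
    nonzero \<open>y\<close> orthogonal to it would be spacelike.\<close>
  then show "lor j y y > 0 \<or> (\<forall>i\<le>j. y i = 0)"
    using timelike_orthogonal[of j x y] by force
next
  define a where "a = sqrt (\<Sum>i<j. y i * y i)"
  have a: "a \<ge> 0" "a * a = (\<Sum>i<j. y i * y i)" by (simp_all add: a_def sum_nonneg)
  assume "lor j y y > 0 \<or> (\<forall>i\<le>j. y i = 0)"
  then have "\<exists>s t. a * s - y j * t = 0 \<and> s * s - t * t \<le> lor j y y - 1"
  proof
    assume pos: "lor j y y > 0"
    \<comment> \<open>In the plane, \<open>(y j, a)\<close> is Lorentz-orthogonal to
      \<open>(a, y j)\<close> and has square \<open>- lor j y y\<close>; the factor \<open>k\<close>
      makes this -1.\<close>
    define k where "k = 1 / sqrt (lor j y y)"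
    have "k * k * lor j y y = 1" using pos by (simp add: k_def)
    moreover have "lor j y y = a * a - y j * y j" using a by (simp add: lor_def)
    ultimately have "(k * y j) * (k * y j) - (k * a) * (k * a) = -1"
      by (simp add: algebra_simps)
    then show ?thesis using pos by (intro exI[of _ "k * y j"] exI[of _ "k * a"]) simp
  next
    assume "\<forall>i\<le>j. y i = 0"
    then have "a = 0" "y j = 0" "lor j y y = 0" by (auto simp: a_def lor_def)
    then show ?thesis by (intro exI[of _ 0] exI[of _ 1]) simp
  qed
  then show "\<exists>x. lor j x x = lor j y y - 1 \<and> lor j x y = 0"
    using lor_solve[OF assms a] by blast
qed

text \<open>Serves the constants -1 and 0, with \<open>h = 1\<close> and \<open>h = 0\<close>.
  Necessity is again \<open>timelike_orthogonal\<close>; for the converse \<open>x\<close> points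
  purely in the transverse direction.\<close>

lemma lor_sol_nonneg:
  assumes "j \<ge> 2" "h \<ge> 0"
  shows "(\<exists>x. lor j x x = lor j y y + h \<and> lor j x y = 0) \<longleftrightarrow> lor j y y + h \<ge> 0"
proof
  assume "\<exists>x. lor j x x = lor j y y + h \<and> lor j x y = 0"
  then obtain x where x: "lor j x x = lor j y y + h" "lor j x y = 0" by blast
  show "lor j y y + h \<ge> 0"
  proof (rule ccontr)
    assume neg: "\<not> ?thesis"
    have "\<exists>i\<le>j. y i \<noteq> 0"
    proof (rule ccontr)
      assume "\<not> ?thesis"
      then have "lor j y y = 0" by (simp add: lor_def)
      then show False using neg assms(2) by simp
    qed
    then show False using timelike_orthogonal[of j x y] x neg assms(2) by force
  qed
next
  define a where "a = sqrt (\<Sum>i<j. y i * y i)"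
  have a: "a \<ge> 0" "a * a = (\<Sum>i<j. y i * y i)" by (simp_all add: a_def sum_nonneg)
  assume "lor j y y + h \<ge> 0"
  then show "\<exists>x. lor j x x = lor j y y + h \<and> lor j x y = 0"
    using lor_solve[OF assms(1) a, of 0 0 0] by simp
qed

text \<open>Completing the square and using \<open>g1\<^sup>2 + g2\<^sup>2 = 1\<close> turns the
  left side into \<open>\<bar>q - g1 / 2\<bar> \<le> 1 / 2\<close>. Of its two halves the upper
  bound is automatic from \<open>q < 0\<close> and \<open>\<bar>g1\<bar> < 1\<close>.\<close>

lemma nonreal_bound:
  fixes q g1 g2 :: real
  assumes "g1\<^sup>2 + g2\<^sup>2 = 1" "g2 \<noteq> 0" "q < 0"
  shows "(q - g1) * q \<le> g2\<^sup>2 / 4 \<longleftrightarrow> - q \<le> (1 - g1) / 2"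
proof -
  have "g2\<^sup>2 > 0" using assms(2) by simp
  then have "g1\<^sup>2 < 1" using assms(1) by linarith
  then have "\<bar>g1\<bar> < 1" by (simp add: abs_square_less_1)
  then have g1: "q - g1 / 2 < 1 / 2" using assms(3) by linarith
  have "(q - g1 / 2)\<^sup>2 - (1 / 2)\<^sup>2 = (q - g1) * q - (1 - g1\<^sup>2) / 4"
    by (simp add: power2_eq_square field_simps)
  then have "(q - g1) * q \<le> g2\<^sup>2 / 4 \<longleftrightarrow> (q - g1 / 2)\<^sup>2 \<le> (1 / 2)\<^sup>2"
    using assms(1) by argo
  also have "\<dots> \<longleftrightarrow> \<bar>q - g1 / 2\<bar> \<le> 1 / 2"
    using abs_le_square_iff[of "q - g1 / 2" "1 / 2"] by simp
  also have "\<dots> \<longleftrightarrow> - q \<le> (1 - g1) / 2"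
    using g1 by (auto simp: abs_le_iff field_simps)
  finally show ?thesis .
qed

lemma lor_sol_nonreal:
  assumes j: "j \<ge> 2" and g: "g1\<^sup>2 + g2\<^sup>2 = 1" "g2 \<noteq> 0"
  shows "(\<exists>x. lor j x x = lor j y y - g1 \<and> 2 * lor j x y = - g2)
    \<longleftrightarrow> - lor j y y \<le> (1 - g1) / 2 \<and> (\<exists>i\<le>j. y i \<noteq> 0)"
proof
  assume "\<exists>x. lor j x x = lor j y y - g1 \<and> 2 * lor j x y = - g2"
  then obtain x where x: "lor j x x = lor j y y - g1" "lor j x y = - g2 / 2" by auto
  have "\<exists>i\<le>j. y i \<noteq> 0"
  proof (rule ccontr)
    assume "\<not> ?thesis"
    then have "lor j x y = 0" by (simp add: lor_def)
    then show False using x(2) g(2) by simp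
  qed
  moreover have "- lor j y y \<le> (1 - g1) / 2"
  proof (cases "lor j y y < 0")
    case True
    then have "(lor j y y - g1) * lor j y y \<le> g2\<^sup>2 / 4"
      using reversed_Cauchy_Schwarz[OF True, of x] x by (simp add: power2_eq_square)
    then show ?thesis using nonreal_bound[OF g True] by simp
  next
    case False
    have "g1\<^sup>2 \<le> 1" using g(1) zero_le_power2[of g2] by linarith
    then have "g1 \<le> 1" by (simp add: abs_square_le_1)
    then show ?thesis using False by simp
  qed
  ultimately show "- lor j y y \<le> (1 - g1) / 2 \<and> (\<exists>i\<le>j. y i \<noteq> 0)" by simp
next
  assume "- lor j y y \<le> (1 - g1) / 2 \<and> (\<exists>i\<le>j. y i \<noteq> 0)"
  then obtain i where le: "- lor j y y \<le> (1 - g1) / 2" and i: "i \<le> j" "y i \<noteq> 0" by blast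
  define a where "a = sqrt (\<Sum>i<j. y i * y i)"
  define b where "b = y j"
  define q where "q = lor j y y"
  define d where "d = - g2 / 2"
  have d: "d \<noteq> 0" "d * d = g2\<^sup>2 / 4" using g(2) by (simp_all add: d_def power2_eq_square)
  have a: "a \<ge> 0" "a * a = (\<Sum>i<j. y i * y i)" by (simp_all add: a_def sum_nonneg)
  have q: "q = a * a - b * b" using a(2) by (simp add: q_def lor_def b_def)
  have "\<exists>s t. a * s - b * t = d \<and> s * s - t * t \<le> q - g1"
  \<comment> \<open>For null \<open>y\<close> the plane vectors \<open>(a, b)\<close> and
    \<open>(b, a)\<close> are parallel, so they cannot serve as a basis and this case is solved
    separately.\<close>
  proof (cases "q = 0")
    case True
    have "a \<noteq> 0"
    proof
      assume "a = 0"
      then have "b = 0" "\<forall>i<j. y i = 0" using q True a(2) by (auto simp: sum_nonneg_eq_0_iff)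
      then show False using i by (metis b_def le_neq_implies_less)
    qed
    \<comment> \<open>Because \<open>b * b = a * a\<close>, the condition
      \<open>a * s - b * t = d\<close> makes \<open>a * a * (s * s - t * t)\<close> affine in
      \<open>t\<close>. This \<open>t\<close>, available since \<open>d\<close> is nonzero, gives
      \<open>s * s - t * t\<close> the value \<open>- g1\<close>.\<close>
    define t where "t = b * (- g1 - d * d / (a * a)) / (2 * d)"
    define s where "s = (b * t + d) / a"
    have s: "a * s = b * t + d" using \<open>a \<noteq> 0\<close> by (simp add: s_def)
    have bb: "b * b = a * a" using q True by simp
    have "a * a * (s * s - t * t) = (a * s) * (a * s) - (b * b) * (t * t)"
      by (simp add: bb algebra_simps)
    also have "\<dots> = 2 * d * (b * t) + d * d" by (simp add: s algebra_simps)
    also have "b * t = (a * a) * (- g1 - d * d / (a * a)) / (2 * d)"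
      by (simp add: t_def mult.assoc flip: bb)
    also have "2 * d * ((a * a) * (- g1 - d * d / (a * a)) / (2 * d)) + d * d = a * a * (- g1)"
      using d(1) \<open>a \<noteq> 0\<close> by (simp add: field_simps)
    finally have "s * s - t * t = - g1" using \<open>a \<noteq> 0\<close> by (metis mult_cancel_left no_zero_divisors)
    then show ?thesis using s True by (intro exI[of _ s] exI[of _ t]) simp
  next
    case False
    \<comment> \<open>The ansatz combines \<open>(a, b)\<close>, of square \<open>q\<close>, with
      the orthogonal \<open>(b, a)\<close>, of square \<open>- q\<close>. The product with
      \<open>y\<close> fixes \<open>\<tau>\<close>. For \<open>q > 0\<close> a large
      \<open>k\<close> lowers the square at will; for \<open>q < 0\<close> the choice
      \<open>k = 0\<close> gives the least square, and \<open>nonreal_bound\<close> says that it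
      suffices.\<close>
    define \<tau> where "\<tau> = d / q"
    have \<tau>: "\<tau> * q = d" using False by (simp add: \<tau>_def)
    define k where "k = (if q > 0 then sqrt (\<bar>d * d / q - q + g1\<bar> / q) else 0)"
    let ?s = "\<tau> * a + k * b" and ?t = "\<tau> * b + k * a"
    have "a * ?s - b * ?t = \<tau> * q" by (simp add: q algebra_simps)
    moreover have "?s * ?s - ?t * ?t = \<tau> * \<tau> * q - k * k * q" by (simp add: q algebra_simps)
    moreover have "\<tau> * \<tau> * q = d * d / q" using False by (simp add: \<tau>_def)
    moreover have "d * d / q - k * k * q \<le> q - g1"
    proof (cases "q > 0")
      case True
      then have "k * k * q = \<bar>d * d / q - q + g1\<bar>" by (simp add: k_def)
      then show ?thesis by linarith
    next
      case neg: False
      then have "q < 0" using False by simp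
      then have "(q - g1) * q \<le> d * d" using nonreal_bound[OF g] le by (simp add: d q_def)
      then have "d * d / q \<le> q - g1" using \<open>q < 0\<close> by (simp add: divide_le_eq)
      then show ?thesis using neg by (simp add: k_def)
    qed
    ultimately show ?thesis using \<tau> by (intro exI[of _ ?s] exI[of _ ?t]) simp
  qed
  then obtain x where "lor j x x = q - g1" "lor j x y = d"
    using lor_solve[OF j a] unfolding b_def by blast
  then show "\<exists>x. lor j x x = lor j y y - g1 \<and> 2 * lor j x y = - g2"
    by (auto simp: q_def d_def)
qed

section \<open>Imaginary projections of the normal forms with a linear part\<close>

lemma imag_proj_carrier: "imag_proj n q \<subseteq> carrier_vec n"
  by (auto simp: imag_proj_iff)

text \<open>The coefficients 1 and \<open>\<i>\<close> put the real parts of the two linear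
  variables into different equations, so each solves one of them with all other real parts
  0.\<close>

lemma imag_proj_complex_lines:
  "imag_proj (j + 3) (nf j 1 \<i> \<gamma>) = carrier_vec (j + 3)"
proof -
  have "y \<in> imag_proj (j + 3) (nf j 1 \<i> \<gamma>)" if y: "y \<in> carrier_vec (j + 3)" for y
  proof -
    let ?Y = "\<lambda>i. y $ i"
    define x where "x i = (if i = j + 1 then lor j ?Y ?Y + y $ (j + 2) - Re \<gamma>
       else if i = j + 2 then - y $ (j + 1) - Im \<gamma> else 0)" for i
    have "lor j x x = 0" "lor j x ?Y = 0" by (simp_all add: lor_def x_def)
    then have "eval (nf j 1 \<i> \<gamma>) (vec (j + 3) (\<lambda>i. Complex (x i) (y $ i))) = 0"
      unfolding eval_nf by (simp only: complex_quadric) (simp add: complex_eq_iff x_def)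
    then show ?thesis using y unfolding imag_proj_iff by blast
  qed
  then show ?thesis using imag_proj_carrier by blast
qed

text \<open>\<open>lor j\<close> ignores coordinate \<open>j + 1\<close>, so the real part
  \<open>t\<close> of the linear variable is a free parameter next to \<open>x\<close>.\<close>

lemma imag_proj_nf_line_iff:
  "y \<in> imag_proj (j + 2) (nf j \<alpha> 0 0) \<longleftrightarrow> y \<in> carrier_vec (j + 2) \<and>
     (\<exists>x t. lor j x x - lor j (\<lambda>i. y $ i) (\<lambda>i. y $ i) + Re \<alpha> * t - Im \<alpha> * y $ (j + 1) = 0 \<and>
        2 * lor j x (\<lambda>i. y $ i) + Re \<alpha> * y $ (j + 1) + Im \<alpha> * t = 0)" (is "_ \<longleftrightarrow> _ \<and> (\<exists>x t. ?P x t)")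
proof -
  have ev: "eval (nf j \<alpha> 0 0) (vec (j + 2) (\<lambda>i. Complex (x i) (y $ i))) = 0 \<longleftrightarrow> ?P x (x (j + 1))" for x
    unfolding eval_nf by (simp only: complex_quadric) (simp add: complex_eq_iff algebra_simps)
  have "\<exists>x. ?P x (x (j + 1))" if "?P x t" for x t
  proof -
    define x' where "x' = x(j + 1 := t)"
    have "lor j x' x' = lor j x x" "lor j x' (\<lambda>i. y $ i) = lor j x (\<lambda>i. y $ i)"
      by (auto simp: x'_def intro!: lor_cong)
    moreover have "x' (j + 1) = t" by (simp add: x'_def)
    ultimately have "?P x' (x' (j + 1))" using that by simp
    then show ?thesis by blast
  qed
  then show ?thesis unfolding imag_proj_iff ev by blast
qed

text \<open>For real \<open>\<alpha>\<close>, \<open>t\<close> occurs only in the real equation and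
  solves it for every \<open>x\<close>. The imaginary equation is affine in \<open>x\<close>; it is
  unsolvable exactly when its linear part vanishes and its constant does not, which gives the
  punctured axis.\<close>

lemma imag_proj_real_line:
  assumes \<alpha>: "\<alpha> = of_real a" "a \<noteq> 0"
  shows "imag_proj (j + 2) (nf j \<alpha> 0 0) =
    carrier_vec (j + 2) - {y \<in> carrier_vec (j + 2). (\<forall>i<j + 1. y $ i = 0) \<and> y $ (j + 1) \<noteq> 0}"
proof -
  have "y \<in> imag_proj (j + 2) (nf j \<alpha> 0 0) \<longleftrightarrow> \<not> ((\<forall>i<j + 1. y $ i = 0) \<and> y $ (j + 1) \<noteq> 0)"
    if y: "y \<in> carrier_vec (j + 2)" for y
  proof -
    let ?Y = "\<lambda>i. y $ i"
    have "y \<in> imag_proj (j + 2) (nf j \<alpha> 0 0) \<longleftrightarrow>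
      (\<exists>x t. lor j x x - lor j ?Y ?Y + a * t = 0 \<and> 2 * lor j x ?Y + a * y $ (j + 1) = 0)"
      unfolding imag_proj_nf_line_iff using y \<alpha>(1) by simp
    also have "\<dots> \<longleftrightarrow> (\<exists>x. 2 * lor j x ?Y + a * y $ (j + 1) = 0)"
    proof -
      have "lor j x x - lor j ?Y ?Y + a * ((lor j ?Y ?Y - lor j x x) / a) = 0" for x
        using \<alpha>(2) by simp
      then show ?thesis by blast
    qed
    also have "\<dots> \<longleftrightarrow> \<not> ((\<forall>i<j + 1. y $ i = 0) \<and> y $ (j + 1) \<noteq> 0)"
    proof (cases "\<forall>i<j + 1. y $ i = 0")
      case True
      then have "lor j x ?Y = 0" for x by (simp add: lor_def)
      then show ?thesis using True \<alpha>(2) by simp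
    next
      case False
      then obtain i where i: "i \<le> j" "y $ i \<noteq> 0" by (auto simp: less_Suc_eq_le)
      have "lor j (unit_fun i) ?Y = signature j i * y $ i"
      proof (cases "i = j")
        case True
        have "(\<Sum>k<j. unit_fun j k * y $ k) = 0" by (simp add: unit_fun_def)
        then show ?thesis using True by (simp add: lor_def signature_def) (simp add: unit_fun_def)
      next
        case False
        then have "(\<Sum>k<j. unit_fun i k * y $ k) = y $ i"
          using i dot_unit[of i j ?Y] by (simp add: dot_def)
        then show ?thesis using False by (simp add: lor_def signature_def) (simp add: unit_fun_def)
      qed
      then have "lor j (unit_fun i) ?Y \<noteq> 0" using i by (simp add: signature_def)
      moreover define c where "c = - a * y $ (j + 1) / (2 * lor j (unit_fun i) ?Y)"
      ultimately have "c * lor j (unit_fun i) ?Y = - a * y $ (j + 1) / 2" by simp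
      then have "2 * lor j (\<lambda>k. c * unit_fun i k) ?Y + a * y $ (j + 1) = 0"
        by (simp add: lor_scale_left)
      then show ?thesis using False by blast
    qed
    finally show ?thesis .
  qed
  then show ?thesis using imag_proj_carrier by blast
qed

text \<open>The imaginary equation determines \<open>t\<close>; inserting it into the real one
  prescribes \<open>lor j x x - 2 * k * lor j x ?Y\<close>. With \<open>x = u + k ?Y\<close> the
  square is completed, and only the value \<open>lor j u u\<close> is prescribed.\<close>

lemma imag_proj_nonreal_line:
  assumes \<alpha>: "Im \<alpha> \<noteq> 0" and j: "j \<ge> 1"
  shows "imag_proj (j + 2) (nf j \<alpha> 0 0) = carrier_vec (j + 2)"
proof -
  have "y \<in> imag_proj (j + 2) (nf j \<alpha> 0 0)" if y: "y \<in> carrier_vec (j + 2)" for y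
  proof -
    let ?Y = "\<lambda>i. y $ i"
    define k where "k = Re \<alpha> / Im \<alpha>"
    have "\<exists>x. lor j x x = T" for T :: real
    proof -
      \<comment> \<open>The coordinates 0 and \<open>j\<close>, distinct as
        \<open>j \<ge> 1\<close>, supply the positive and the negative values.\<close>
      define x where "x i = (if i = 0 then sqrt (max T 0) else if i = j then sqrt (max (- T) 0) else 0)" for i
      have "(\<Sum>i<j. x i * x i) = (\<Sum>i\<in>{0}. x i * x i)"
        using j by (intro sum.mono_neutral_right) (auto simp: x_def)
      then have "lor j x x = T" using j by (simp add: lor_def x_def max_def)
      then show ?thesis by blast
    qed
    then obtain u where u: "lor j u u = lor j ?Y ?Y + k * Re \<alpha> * y $ (j + 1) + Im \<alpha> * y $ (j + 1)
       + k * k * lor j ?Y ?Y" by blast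
    define x where "x = (\<lambda>i. u i + k * ?Y i)"
    define t where "t = - (2 * lor j x ?Y + Re \<alpha> * y $ (j + 1)) / Im \<alpha>"
    have uy: "lor j x ?Y = lor j u ?Y + k * lor j ?Y ?Y"
      by (simp add: x_def lor_add_left lor_scale_left)
    have xx: "lor j x x = lor j u u + 2 * k * lor j u ?Y + k * k * lor j ?Y ?Y"
      using lor_commute[of j ?Y u]
      by (simp add: x_def lor_add_left lor_scale_left lor_add_right lor_scale_right algebra_simps)
    have t: "Im \<alpha> * t = - (2 * lor j x ?Y + Re \<alpha> * y $ (j + 1))"
      using \<alpha> by (simp add: t_def)
    have "Re \<alpha> * t = k * (Im \<alpha> * t)" using \<alpha> by (simp add: k_def)
    then have "Re \<alpha> * t = - k * (2 * lor j x ?Y + Re \<alpha> * y $ (j + 1))"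
      unfolding t by (simp only: mult_minus_left mult_minus_right)
    then have "lor j x x - lor j ?Y ?Y + Re \<alpha> * t - Im \<alpha> * y $ (j + 1) = 0"
      by (simp add: xx uy u algebra_simps)
    moreover have "2 * lor j x ?Y + Re \<alpha> * y $ (j + 1) + Im \<alpha> * t = 0"
      using \<alpha> by (simp add: t_def)
    ultimately show ?thesis unfolding imag_proj_nf_line_iff using y by blast
  qed
  then show ?thesis using imag_proj_carrier by blast
qed

section \<open>Imaginary projections of the Lorentzian normal forms\<close>

lemma imag_proj_lorentz_iff:
  "y \<in> imag_proj (j + 1) (nf j 0 0 \<gamma>) \<longleftrightarrow> y \<in> carrier_vec (j + 1) \<and>
     (\<exists>x. lor j x x = lor j (\<lambda>i. y $ i) (\<lambda>i. y $ i) - Re \<gamma> \<and> 2 * lor j x (\<lambda>i. y $ i) = - Im \<gamma>)"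
proof -
  have "eval (nf j 0 0 \<gamma>) (vec (j + 1) (\<lambda>i. Complex (x i) (y $ i))) = 0 \<longleftrightarrow>
     lor j x x = lor j (\<lambda>i. y $ i) (\<lambda>i. y $ i) - Re \<gamma> \<and> 2 * lor j x (\<lambda>i. y $ i) = - Im \<gamma>" for x
    unfolding eval_nf by (simp only: complex_quadric) (auto simp: complex_eq_iff)
  then show ?thesis unfolding imag_proj_iff by blast
qed

lemma lor_self: "lor j y y = (\<Sum>i<j. (y i)\<^sup>2) - (y j)\<^sup>2"
  by (simp add: lor_def power2_eq_square)

lemma zero_vec_iff: "y \<in> carrier_vec (j + 1) \<Longrightarrow> y = 0\<^sub>v (j + 1) \<longleftrightarrow> (\<forall>i\<le>j. y $ i = 0)"
  by (auto intro!: eq_vecI)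

lemma imag_proj_lorentz_one:
  assumes "j \<ge> 2"
  shows "imag_proj (j + 1) (nf j 0 0 1) =
    {y \<in> carrier_vec (j + 1). (y $ j)\<^sup>2 < (\<Sum>i<j. (y $ i)\<^sup>2)} \<union> {0\<^sub>v (j + 1)}"
proof -
  have "y \<in> imag_proj (j + 1) (nf j 0 0 1) \<longleftrightarrow> (y $ j)\<^sup>2 < (\<Sum>i<j. (y $ i)\<^sup>2) \<or> y = 0\<^sub>v (j + 1)"
    if "y \<in> carrier_vec (j + 1)" for y
    unfolding imag_proj_lorentz_iff zero_vec_iff[OF that]
    using lor_sol_spacelike[OF assms, of "\<lambda>i. y $ i"] that by (simp add: lor_self)
  then show ?thesis using imag_proj_carrier zero_carrier_vec by blast
qed

lemma imag_proj_lorentz_nonpos: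
  assumes "j \<ge> 2" "h \<ge> 0"
  shows "imag_proj (j + 1) (nf j 0 0 (- of_real h)) =
    {y \<in> carrier_vec (j + 1). (y $ j)\<^sup>2 - (\<Sum>i<j. (y $ i)\<^sup>2) \<le> h}"
proof -
  have "y \<in> imag_proj (j + 1) (nf j 0 0 (- of_real h)) \<longleftrightarrow> (y $ j)\<^sup>2 - (\<Sum>i<j. (y $ i)\<^sup>2) \<le> h"
    if "y \<in> carrier_vec (j + 1)" for y
    unfolding imag_proj_lorentz_iff
    using lor_sol_nonneg[OF assms, of "\<lambda>i. y $ i"] that by (auto simp: lor_self)
  then show ?thesis using imag_proj_carrier by blast
qed

lemma imag_proj_lorentz_nonreal:
  assumes "j \<ge> 2" "cmod \<gamma> = 1" "\<gamma> \<notin> \<real>"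
  shows "imag_proj (j + 1) (nf j 0 0 \<gamma>) =
    {y \<in> carrier_vec (j + 1). (y $ j)\<^sup>2 - (\<Sum>i<j. (y $ i)\<^sup>2) \<le> (1 - Re \<gamma>) / 2} - {0\<^sub>v (j + 1)}"
proof -
  have \<gamma>: "(Re \<gamma>)\<^sup>2 + (Im \<gamma>)\<^sup>2 = 1" "Im \<gamma> \<noteq> 0"
    using assms(2,3) by (auto simp: cmod_def complex_is_Real_iff)
  have "y \<in> imag_proj (j + 1) (nf j 0 0 \<gamma>) \<longleftrightarrow>
    (y $ j)\<^sup>2 - (\<Sum>i<j. (y $ i)\<^sup>2) \<le> (1 - Re \<gamma>) / 2 \<and> y \<noteq> 0\<^sub>v (j + 1)"
    if "y \<in> carrier_vec (j + 1)" for y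
    unfolding imag_proj_lorentz_iff zero_vec_iff[OF that]
    using lor_sol_nonreal[OF assms(1) \<gamma>, of "\<lambda>i. y $ i"] that by (simp add: lor_self)
  then show ?thesis using imag_proj_carrier by blast
qed

section \<open>Reduction to a normal form and the number of its variables\<close>

lemma quadratic_normal_form:
  assumes "indets p \<subseteq> {..<n}" "total_degree p = 2" "hyperbolic n (initial_form p)"
  obtains g c j \<alpha> r \<gamma> m where "g \<in> G n" "c \<noteq> 0" "act n g p = Const c * nf j \<alpha> r \<gamma>" "m \<le> n"
    "\<alpha> = 0 \<and> r = 0 \<and> m = j + 1 \<and> (\<gamma> = 0 \<or> cmod \<gamma> = 1) \<or>
     \<alpha> \<noteq> 0 \<and> r = 0 \<and> \<gamma> = 0 \<and> m = j + 2 \<or>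
     \<alpha> = 1 \<and> r = \<i> \<and> m = j + 3"
proof -
  obtain j c f v d \<mu> \<gamma> where c: "c \<noteq> 0"
    and fv: "\<And>r s. r \<le> j \<Longrightarrow> s \<le> j \<Longrightarrow> dot n (f r) (v s) = (if r = s then signature j s else 0)"
    and \<mu>v: "\<And>s. s \<le> j \<Longrightarrow> dot n \<mu> (\<lambda>i. complex_of_real (v s i)) = 0"
    and p: "p = Const c * ((\<Sum>r\<le>j. Const (of_real (signature j r)) * (rlin n (f r) + Const (d r))\<^sup>2)
       + lin n \<mu> + Const \<gamma>)"
    by (rule diagonal_decomposition[OF assms], rule that)
  let ?T = "\<lambda>r. Const (of_real (signature j r)) * (rlin n (f r) + Const (d r))\<^sup>2"
  consider (zero) "\<forall>i<n. \<mu> i = 0"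
    | (line) \<alpha> h i0 where "\<alpha> \<noteq> 0" "\<forall>i<n. \<mu> i = \<alpha> * of_real (h i)" "i0 < n" "h i0 \<noteq> 0"
    | (plane) "\<forall>a b. (\<forall>i<n. a * Re (\<mu> i) + b * Im (\<mu> i) = 0) \<longrightarrow> a = 0 \<and> b = 0"
  proof -
    have "\<exists>\<alpha> h i0. \<alpha> \<noteq> 0 \<and> (\<forall>i<n. \<mu> i = \<alpha> * of_real (h i)) \<and> i0 < n \<and> h i0 \<noteq> 0"
      if i0: "i0 < n" "\<mu> i0 \<noteq> 0" and ab: "\<forall>i<n. a * Re (\<mu> i) + b * Im (\<mu> i) = 0" "a \<noteq> 0 \<or> b \<noteq> 0" for i0 a b
    proof -
      \<comment> \<open>The relation makes every value of \<open>\<mu>\<close> a real multiple of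
        \<open>b - a * \<i>\<close>; for \<open>b = 0\<close> the real parts vanish and
        \<open>\<mu>\<close> is purely imaginary.\<close>
      define h where "h i = (if b = 0 then Im (\<mu> i) else Re (\<mu> i) / b)" for i
      define \<alpha> where "\<alpha> = (if b = 0 then \<i> else Complex b (- a))"
      have "\<mu> i = \<alpha> * of_real (h i)" if "i < n" for i
        using ab that by (auto simp: \<alpha>_def h_def complex_eq_iff field_simps add_eq_0_iff)
      moreover have "\<alpha> \<noteq> 0" by (auto simp: \<alpha>_def complex_eq_iff)
      ultimately show ?thesis using i0 by (metis mult_zero_right of_real_0)
    qed
    then show thesis using that by blast
  qed
  then show thesis
  proof cases
    case zero
    then have \<mu>0: "lin n \<mu> = 0" by (simp add: lin_def)
    \<comment> \<open>Dividing all forms by \<open>s\<close> divides the constant by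
      \<open>s\<^sup>2\<close>, which leaves modulus 1 unless the constant is 0. The factor moves
      into \<open>c\<close>, and the test vectors are multiplied by \<open>s\<close> to keep the
      pairing.\<close>
    define s where "s = (if \<gamma> = 0 then 1 else sqrt (cmod \<gamma>))"
    have s: "s \<noteq> 0" "\<gamma> \<noteq> 0 \<Longrightarrow> s\<^sup>2 = cmod \<gamma>" by (auto simp: s_def)
    define S where "S = complex_of_real s"
    have S: "S \<noteq> 0" using s by (simp add: S_def)
    define f' where "f' r = (\<lambda>i. 1 / s * f r i)" for r
    have L: "rlin n (f r) + Const (d r) = Const S * (rlin n (f' r) + Const (d r / S))" for r
    proof -
      have "rlin n (f r) = lin n (\<lambda>i. S * of_real (f' r i))" using s by (simp add: S_def f'_def)
      then have "rlin n (f r) = Const S * rlin n (f' r)" by (simp only: lin_scale)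
      moreover have "Const (d r) = Const S * Const (d r / S)" using S by (simp flip: Const_mult)
      ultimately show ?thesis by (simp only: distrib_left)
    qed
    have \<gamma>: "Const \<gamma> = Const (S\<^sup>2) * Const (\<gamma> / S\<^sup>2)" using S by (simp flip: Const_mult)
    have "p = Const (c * S\<^sup>2) * ((\<Sum>r\<le>j. Const (of_real (signature j r)) * (rlin n (f' r) + Const (d r / S))\<^sup>2)
       + Const (\<gamma> / S\<^sup>2))"
      unfolding p \<mu>0 L \<gamma> power_mult_distrib Const_mult Const_power
      by (simp add: sum_distrib_left distrib_left mult_ac)
    moreover have "indep_forms n (j + 1) f'"
    proof (rule indep_formsI[where j = j and v = "\<lambda>r i. s * v r i"])
      show "dot n (f' r) (\<lambda>i. s * v t i) = (if r = t then signature j t else 0)" if "r < j + 1" "t \<le> j" for r t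
        using fv[of r t] that s(1) unfolding f'_def dot_scale_left dot_scale_right by simp
    qed auto
    ultimately obtain g where "g \<in> G n" "act n g p = Const (c * S\<^sup>2) * nf j 0 0 (\<gamma> / S\<^sup>2)" "j + 1 \<le> n"
      using act_normal_form[of n "j + 1" f' j 0 0 p "c * S\<^sup>2" "\<lambda>r. d r / S" "\<gamma> / S\<^sup>2"] by auto
    moreover have "\<gamma> / S\<^sup>2 = 0 \<or> cmod (\<gamma> / S\<^sup>2) = 1"
      using s by (auto simp: S_def norm_divide norm_power)
    ultimately show thesis using c S that[of g "c * S\<^sup>2" j 0 0 "\<gamma> / S\<^sup>2" "j + 1"] by simp
  next
    case (line \<alpha> h i0)
    have lin: "lin n \<mu> = Const \<alpha> * rlin n h"
      unfolding lin_scale[symmetric] using line by (intro lin_cong) auto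
    define f' where "f' = f(j + 1 := h)"
    \<comment> \<open>The constant term becomes a translation of the linear variable, so none is
      left in the normal form.\<close>
    define d' where "d' = d(j + 1 := \<gamma> / \<alpha>)"
    have "Const \<gamma> = Const \<alpha> * Const (\<gamma> / \<alpha>)" using line by (simp flip: Const_mult)
    then have p': "p = Const c * ((\<Sum>i\<le>j. Const (of_real (signature j i)) * (rlin n (f' i) + Const (d' i))\<^sup>2)
       + Const \<alpha> * (rlin n (f' (j + 1)) + Const (d' (j + 1)))
       + Const 0 * (rlin n (f' (j + 2)) + Const (d' (j + 2))) + Const 0)"
      unfolding p lin by (simp add: f'_def d'_def distrib_left add.assoc)
    have ind: "indep_forms n (j + 2) f'"
    proof (rule indep_formsI[where j = j and v = v])
      have "dot n h (v t) = 0" if "t \<le> j" for t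
      proof -
        have "dot n \<mu> (\<lambda>i. complex_of_real (v t i)) = dot n (\<lambda>i. \<alpha> * of_real (h i)) (\<lambda>i. complex_of_real (v t i))"
          using line by (intro dot_cong) auto
        then show ?thesis using \<mu>v[OF that] line(1) by (simp add: dot_scale_left dot_of_real)
      qed
      then show "dot n (f' r) (v t) = (if r = t then signature j t else 0)" if "r < j + 2" "t \<le> j" for r t
        using that fv[of r t] by (auto simp: f'_def)
      show "\<forall>r\<in>{j<..<j + 2}. a r = 0" if "\<And>i. i < n \<Longrightarrow> (\<Sum>r\<in>{j<..<j + 2}. a r * f' r i) = 0" for a
      proof -
        have "{j<..<j + 2} = {j + 1}" by auto
        then show ?thesis using that[OF line(3)] line(4) by (simp add: f'_def)
      qed
    qed auto
    obtain g where "g \<in> G n" "act n g p = Const c * nf j \<alpha> 0 0" "j + 2 \<le> n"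
      using act_normal_form[OF ind _ _ _ p'] by auto
    then show thesis using c line(1) that[of g c j \<alpha> 0 0 "j + 2"] by simp
  next
    case plane
    have "lin n \<mu> = lin n (\<lambda>i. of_real (Re (\<mu> i)) + \<i> * of_real (Im (\<mu> i)))"
      by (intro lin_cong) (rule complex_eq)
    then have lin: "lin n \<mu> = rlin n (\<lambda>i. Re (\<mu> i)) + Const \<i> * rlin n (\<lambda>i. Im (\<mu> i))"
      by (simp only: lin_add lin_scale)
    define f' where "f' = f(j + 1 := \<lambda>i. Re (\<mu> i), j + 2 := \<lambda>i. Im (\<mu> i))"
    define d' where "d' = d(j + 1 := 0, j + 2 := 0)"
    have p': "p = Const c * ((\<Sum>i\<le>j. Const (of_real (signature j i)) * (rlin n (f' i) + Const (d' i))\<^sup>2)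
       + Const 1 * (rlin n (f' (j + 1)) + Const (d' (j + 1)))
       + Const \<i> * (rlin n (f' (j + 2)) + Const (d' (j + 2))) + Const \<gamma>)"
      unfolding p lin by (simp add: f'_def d'_def add.assoc)
    have ind: "indep_forms n (j + 3) f'"
    proof (rule indep_formsI[where j = j and v = v])
      have "dot n (\<lambda>i. Re (\<mu> i)) (v t) = 0" "dot n (\<lambda>i. Im (\<mu> i)) (v t) = 0" if "t \<le> j" for t
        using \<mu>v[OF that] by (auto simp: dot_def complex_eq_iff)
      then show "dot n (f' r) (v t) = (if r = t then signature j t else 0)" if "r < j + 3" "t \<le> j" for r t
        using that fv[of r t] by (auto simp: f'_def)
      show "\<forall>r\<in>{j<..<j + 3}. a r = 0" if "\<And>i. i < n \<Longrightarrow> (\<Sum>r\<in>{j<..<j + 3}. a r * f' r i) = 0" for a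
      proof -
        have two: "{j<..<j + 3} = {j + 1, j + 2}" by auto
        have "\<forall>i<n. a (j + 1) * Re (\<mu> i) + a (j + 2) * Im (\<mu> i) = 0"
          using that unfolding two by (simp add: f'_def)
        then show ?thesis using plane unfolding two by blast
      qed
    qed auto
    obtain g where "g \<in> G n" "act n g p = Const c * nf j 1 \<i> \<gamma>" "j + 3 \<le> n"
      using act_normal_form[OF ind _ _ _ p'] by auto
    then show thesis using c that[of g c j 1 \<i> \<gamma> "j + 3"] by simp
  qed
qed

lemma indets_nf:
  assumes "j < m" "\<alpha> = 0 \<or> j + 1 < m" "r = 0 \<or> j + 2 < m"
  shows "indets (nf j \<alpha> r \<gamma>) \<subseteq> {..<m}"
proof -
  define P where "P q \<longleftrightarrow> indets q \<subseteq> {..<m}" for q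
  have add: "P (a + b)" if "P a" "P b" for a b using that indets_add[of a b] by (auto simp: P_def)
  have diff: "P (a - b)" if "P a" "P b" for a b
    using that indets_add[of a "- b"] by (auto simp: P_def)
  have power: "P (a ^ k)" if "P a" for a k using that indets_power[of a k] by (auto simp: P_def)
  have sum: "P (\<Sum>i<j. Var i ^ 2)"
    using indets_sum[of "\<lambda>i. Var i ^ 2" "{..<j}"] indets_power[of "Var i" 2 for i] assms(1)
    by (fastforce simp: P_def)
  have monomial: "P (Const a * Var i)" if "a = 0 \<or> i < m" for a i
  proof (cases "a = 0")
    case True
    then show ?thesis using indets_Const[of 0] by (simp add: P_def)
  next
    case False
    then show ?thesis using that indets_mult[of "Const a" "Var i"] by (auto simp: P_def)
  qed
  have "P (Var j)" "P (Const \<gamma>)" using assms(1) by (auto simp: P_def)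
  then have "P (nf j \<alpha> r \<gamma>)"
    unfolding nf_def using assms by (intro add diff power sum monomial)
  then show ?thesis by (simp add: P_def)
qed

text \<open>Guarantees that the maximum in \<open>largest_index\<close> is over a nonempty set.
  Along the axis of \<open>Var j\<close> the polynomial is \<open>- t\<^sup>2 + \<gamma>\<close>,
  which is not constant.\<close>

lemma indets_nf_nonempty: "indets (nf j \<alpha> r \<gamma>) \<noteq> {}"
proof
  assume "indets (nf j \<alpha> r \<gamma>) = {}"
  then obtain k where k: "nf j \<alpha> r \<gamma> = Const k" using indets_empty_const by blast
  let ?z = "\<lambda>t. vec (j + 3) (\<lambda>i. if i = j then t else 0)"
  have "eval (nf j \<alpha> r \<gamma>) (?z t) = - t\<^sup>2 + \<gamma>" for t by (simp add: eval_nf)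
  from this[of 0] this[of 1] k show False by (simp add: eval.hom_Const)
qed

lemma largest_index_bound:
  assumes "indets q \<subseteq> {..<m}" "indets q \<noteq> {}"
  shows "largest_index q \<le> m"
proof -
  have "finite (indets q)" using assms(1) finite_subset by blast
  then show ?thesis using assms by (auto simp: largest_index_def)
qed

text \<open>A form in the first \<open>m\<close> variables has largest index at most
  \<open>m\<close>, while \<open>norm\<close> demands \<open>n\<close>.\<close>

lemma largest_index_nf:
  assumes n: "n \<ge> 3" and norm: "\<And>q. normal_form_of n p q \<Longrightarrow> largest_index q = n"
    and g: "g \<in> G n" "c \<noteq> 0" "act n g p = Const c * nf j \<alpha> r \<gamma>"
    and m: "m \<le> n" "j < m" "\<alpha> = 0 \<or> j + 1 < m" "r = 0 \<or> j + 2 < m"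
  shows "m = n"
proof -
  have ind: "indets (nf j \<alpha> r \<gamma>) \<subseteq> {..<m}" using m(2-4) by (rule indets_nf)
  have le: "{..<m} \<subseteq> {..<n}" using m(1) by auto
  show ?thesis
  proof (cases "j = 0")
    case False
    have "normal_form n (nf j \<alpha> r \<gamma>)"
      unfolding normal_form_def nf_def[symmetric]
      using ind le m(1,2) False by (auto intro!: exI[of _ j])
    then have "largest_index (nf j \<alpha> r \<gamma>) = n"
      using norm g unfolding normal_form_of_def by blast
    then show ?thesis using largest_index_bound[OF ind indets_nf_nonempty] m(1) by simp
  next
    case True
    \<comment> \<open>For \<open>j = 0\<close> the square comes with coefficient -1; the negated
      polynomial lies in the first family, and the sign passes to the constant factor.\<close>
    let ?q = "- nf j \<alpha> r \<gamma>"
    have "?q = Var 0 ^ 2 + Const (- \<alpha>) * Var 1 + Const (- r) * Var 2 + Const (- \<gamma>)"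
      using True by (simp add: nf_def Const_uminus numeral_2_eq_2)
    moreover have "indets ?q \<subseteq> {..<n}" using subset_trans[OF ind le] by (simp only: indets_uminus)
    ultimately have "normal_form n ?q" unfolding normal_form_def by blast
    moreover have "act n g p = Const (- c) * ?q" using g(3) by (simp add: Const_uminus)
    ultimately have "largest_index ?q = n"
      using norm g unfolding normal_form_of_def by (metis neg_equal_0_iff_equal)
    then show ?thesis using largest_index_bound[of ?q m] ind indets_nf_nonempty m(1) by simp
  qed
qed

lemma lorentz_nf: "lorentz (j + 1) \<gamma> = nf j 0 0 \<gamma>"
  by (simp add: lorentz_def nf_def)

theorem theorem4p5:
  fixes n :: nat and p :: cpoly
  assumes "n \<ge> 3"
    and "indets p \<subseteq> {..<n}"
    and "total_degree p = 2"
    and "hyperbolic n (initial_form p)"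
    and "\<And>q. normal_form_of n p q \<Longrightarrow> largest_index q = n"
  shows "\<exists>g \<in> G n.
      imag_proj n (act n g p) = carrier_vec n
    \<or> imag_proj n (act n g p) =
        carrier_vec n - {y \<in> carrier_vec n. (\<forall>i<n - 1. y $ i = 0) \<and> y $ (n - 1) \<noteq> 0}
    \<or> (\<exists>c \<gamma>. c \<noteq> 0 \<and> act n g p = Const c * lorentz n \<gamma> \<and> cmod \<gamma> = 1
        \<and> (\<gamma> = 1 \<longrightarrow> imag_proj n (act n g p) =
             {y \<in> carrier_vec n. (y $ (n - 1))\<^sup>2 < (\<Sum>i<n - 1. (y $ i)\<^sup>2)} \<union> {0\<^sub>v n})
        \<and> (\<gamma> = - 1 \<longrightarrow> imag_proj n (act n g p) =
             {y \<in> carrier_vec n. (y $ (n - 1))\<^sup>2 - (\<Sum>i<n - 1. (y $ i)\<^sup>2) \<le> 1})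
        \<and> (\<gamma> \<notin> \<real> \<longrightarrow> imag_proj n (act n g p) =
             {y \<in> carrier_vec n. (y $ (n - 1))\<^sup>2 - (\<Sum>i<n - 1. (y $ i)\<^sup>2) \<le> (1 - Re \<gamma>) / 2}
             - {0\<^sub>v n}))
    \<or> (\<exists>c. c \<noteq> 0 \<and> act n g p = Const c * lorentz n 0
        \<and> imag_proj n (act n g p) =
             {y \<in> carrier_vec n. (y $ (n - 1))\<^sup>2 \<le> (\<Sum>i<n - 1. (y $ i)\<^sup>2)})"
proof -
  obtain g c j \<alpha> r \<gamma> m where g: "g \<in> G n" and c: "c \<noteq> 0"
    and act: "act n g p = Const c * nf j \<alpha> r \<gamma>" and "m \<le> n"
    and cases: "\<alpha> = 0 \<and> r = 0 \<and> m = j + 1 \<and> (\<gamma> = 0 \<or> cmod \<gamma> = 1) \<or>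
     \<alpha> \<noteq> 0 \<and> r = 0 \<and> \<gamma> = 0 \<and> m = j + 2 \<or> \<alpha> = 1 \<and> r = \<i> \<and> m = j + 3"
    using quadratic_normal_form[OF assms(2-4)] by metis
  have "m = n"
    by (rule largest_index_nf[OF assms(1,5) g c act \<open>m \<le> n\<close>]) (use cases in auto)
  have proj: "imag_proj n (act n g p) = imag_proj n (nf j \<alpha> r \<gamma>)"
    using c by (simp add: act imag_proj_scale)
  from cases consider (A) "\<alpha> = 0" "r = 0" "n = j + 1" "\<gamma> = 0"
    | (B) "\<alpha> = 0" "r = 0" "n = j + 1" "cmod \<gamma> = 1"
    | (C) "\<alpha> \<noteq> 0" "r = 0" "n = j + 2" "\<gamma> = 0"
    | (D) "\<alpha> = 1" "r = \<i>" "n = j + 3"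
    using \<open>m = n\<close> by auto
  then show ?thesis
  proof cases
    case A
    then have j: "j \<ge> 2" using assms(1) by simp
    have "imag_proj n (act n g p) = {y \<in> carrier_vec n. (y $ (n - 1))\<^sup>2 \<le> (\<Sum>i<n - 1. (y $ i)\<^sup>2)}"
      \<comment> \<open>The homogeneous form is the instance \<open>h = 0\<close>, where the bound
        becomes the closed cone.\<close>
      unfolding proj using imag_proj_lorentz_nonpos[OF j, of 0] A by simp
    moreover have "lorentz n 0 = nf j \<alpha> r \<gamma>" unfolding A by (rule lorentz_nf)
    then have "act n g p = Const c * lorentz n 0" by (simp only: act)
    ultimately show ?thesis using g c by blast
  next
    case B
    then have j: "j \<ge> 2" using assms(1) by simp
    have "lorentz n \<gamma> = nf j \<alpha> r \<gamma>" unfolding B(1-3) by (rule lorentz_nf)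
    then have "act n g p = Const c * lorentz n \<gamma>" by (simp only: act)
    moreover have "\<gamma> = 1 \<longrightarrow> imag_proj n (act n g p) =
             {y \<in> carrier_vec n. (y $ (n - 1))\<^sup>2 < (\<Sum>i<n - 1. (y $ i)\<^sup>2)} \<union> {0\<^sub>v n}"
      unfolding proj using imag_proj_lorentz_one[OF j] B by simp
    moreover have "\<gamma> = - 1 \<longrightarrow> imag_proj n (act n g p) =
             {y \<in> carrier_vec n. (y $ (n - 1))\<^sup>2 - (\<Sum>i<n - 1. (y $ i)\<^sup>2) \<le> 1}"
      unfolding proj using imag_proj_lorentz_nonpos[OF j, of 1] B by simp
    moreover have "\<gamma> \<notin> \<real> \<longrightarrow> imag_proj n (act n g p) =
             {y \<in> carrier_vec n. (y $ (n - 1))\<^sup>2 - (\<Sum>i<n - 1. (y $ i)\<^sup>2) \<le> (1 - Re \<gamma>) / 2} - {0\<^sub>v n}"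
      unfolding proj using imag_proj_lorentz_nonreal[OF j, of \<gamma>] B by simp
    ultimately show ?thesis using g c B(4) by blast
  next
    case C
    show ?thesis
    proof (cases "Im \<alpha> = 0")
      case True
      then have \<alpha>: "\<alpha> = of_real (Re \<alpha>)" "Re \<alpha> \<noteq> 0" using C(1) by (auto simp: complex_eq_iff)
      have "imag_proj n (act n g p) =
        carrier_vec n - {y \<in> carrier_vec n. (\<forall>i<n - 1. y $ i = 0) \<and> y $ (n - 1) \<noteq> 0}"
        unfolding proj using imag_proj_real_line[OF \<alpha>] C by simp
      with g show ?thesis by blast
    next
      case False
      have "imag_proj n (act n g p) = carrier_vec n"
        unfolding proj using imag_proj_nonreal_line[OF False, of j] C assms(1) by simp
      with g show ?thesis by blast
    qed
  next
    case D
    have "imag_proj n (act n g p) = carrier_vec n"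
      unfolding proj using imag_proj_complex_lines[of j \<gamma>] D by simp
    with g show ?thesis by blast
  qed
qed

end
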